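(* For all $i,j,k,l\in\{1,\dots,D\}$ one has $$\operatorname{Cov}(g_i,g_j)=-4h'(0)\,\delta_{ij},$$ $$\operatorname{Cov}\big(H^{(1,1)}_{i,j},H^{(1,1)}_{k,l}\big)=8h''(0)\,(\delta_{ik}\delta_{jl}+\delta_{il}\delta_{jk}),$$ $$\operatorname{Cov}\big(H^{(1,2)}_{i,j},H^{(1,2)}_{k,l}\big)=8h''(0)\,(\delta_{ik}\delta_{jl}-\delta_{il}\delta_{jk}),$$ where $\delta$ is the Kronecker delta.
   Context: Let $D\ge 1$ and write points of $\mathbb{R}^D\times\mathbb{R}^D$ as $x=(x^{(1)},x^{(2)})$, with $x^{flip}=(x^{(2)},x^{(1)})$. A real-valued random field is Gaussian if every finite linear combination of its values is a (possibly degenerate) Gaussian random variable. Let $u$ be a mean-zero isotropic Gaussian field on $\mathbb{R}^D\times\mathbb{R}^D$ with covariance function $k_u(x,y)=h(\|x-y\|_2^2)$, where $h:[0,\infty)\to\mathbb{R}$. The field $f(x)=u(x)-u(x^{flip})$ is called a block isotropic Gaussian field with base field $u$; its covariance function is denoted $k_f$. Standing smoothness assumption: $k_u$ (hence $k_f$) is four times continuously differentiable, and $h$ is twice continuously differentiable on $[0,\infty)$. Derivatives of $f$ are taken in the mean-square ($L^2(\Omega)$) sense. Fix $z^*\in\mathbb{R}^D$ and $z=(z^*,z^* )$. Define the random vector $g\in\mathbb{R}^D$ and random matrices $H^{(1,1)},H^{(1,2)}\in\mathbb{R}^{D\times D}$ by $$g_i=\partial_{x^{(1)}_i}f(x)\big|_{x=z},\quad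 H^{(1,1)}_{i,j}=\partial_{x^{(1)}_i}\partial_{x^{(1)}_j}f(x)\big|_{x=z},\quad H^{(1,2)}_{i,j}=\partial_{x^{(1)}_i}\partial_{x^{(2)}_j}f(x)\big|_{x=z}.$$ *)

theory Defs
  imports "HOL-Probability.Probability"
begin

definition covariance :: "'w measure \<Rightarrow> ('w \<Rightarrow> real) \<Rightarrow> ('w \<Rightarrow> real) \<Rightarrow> real" where
  "covariance M X Y =
     (LINT \<omega>|M. (X \<omega> - (LINT \<omega>'|M. X \<omega>')) * (Y \<omega> - (LINT \<omega>'|M. Y \<omega>')))"

text \<open>The second disjunct is the degenerate case of variance zero.\<close>

definition gaussian_rv :: "'w measure \<Rightarrow> ('w \<Rightarrow> real) \<Rightarrow> bool" where
  "gaussian_rv M X \<longleftrightarrow> X \<in> borel_measurable M \<and>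
     ((\<exists>\<mu> \<sigma>. \<sigma> > 0 \<and> distributed M lborel X (\<lambda>x. ennreal (normal_density \<mu> \<sigma> x))) \<or>
      (\<exists>c. AE \<omega> in M. X \<omega> = c))"

definition gaussian_field :: "'w measure \<Rightarrow> ('a \<Rightarrow> 'w \<Rightarrow> real) \<Rightarrow> bool" where
  "gaussian_field M u \<longleftrightarrow>
     (\<forall>I c. finite I \<longrightarrow> gaussian_rv M (\<lambda>\<omega>. \<Sum>x\<in>I. c x * u x \<omega>))"

definition cov_fun :: "'w measure \<Rightarrow> ('a \<Rightarrow> 'w \<Rightarrow> real) \<Rightarrow> 'a \<times> 'a \<Rightarrow> real" where
  "cov_fun M u = (\<lambda>(x, y). covariance M (u x) (u y))"

definition centered_isotropic_gaussian_field ::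
    "'w measure \<Rightarrow> ('a::euclidean_space \<Rightarrow> 'w \<Rightarrow> real) \<Rightarrow> (real \<Rightarrow> real) \<Rightarrow> bool" where
  "centered_isotropic_gaussian_field M u h \<longleftrightarrow>
     gaussian_field M u \<and>
     (\<forall>x. (LINT \<omega>|M. u x \<omega>) = 0) \<and>
     (\<forall>x y. cov_fun M u (x, y) = h ((norm (x - y))\<^sup>2))"

definition block_field :: "('b \<times> 'b \<Rightarrow> 'w \<Rightarrow> real) \<Rightarrow> 'b \<times> 'b \<Rightarrow> 'w \<Rightarrow> real" where
  "block_field u x \<omega> = u x \<omega> - u (prod.swap x) \<omega>"

text \<open>\<open>n\<close> times continuously differentiable on the whole space.\<close>

primrec Cn :: "nat \<Rightarrow> ('a::euclidean_space \<Rightarrow> real) \<Rightarrow> bool" where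
  "Cn 0 f \<longleftrightarrow> continuous_on UNIV f"
| "Cn (Suc n) f \<longleftrightarrow> (\<forall>x. f differentiable at x) \<and>
     (\<forall>v. Cn n (\<lambda>x. frechet_derivative f (at x) v))"

text \<open>One-sided derivatives are meant at the endpoint \<open>0\<close>.\<close>

definition C2_on_nonneg ::
    "(real \<Rightarrow> real) \<Rightarrow> (real \<Rightarrow> real) \<Rightarrow> (real \<Rightarrow> real) \<Rightarrow> bool" where
  "C2_on_nonneg h h' h'' \<longleftrightarrow>
     (\<forall>t\<ge>0. (h has_real_derivative h' t) (at t within {0..})) \<and>
     (\<forall>t\<ge>0. (h' has_real_derivative h'' t) (at t within {0..})) \<and>
     continuous_on {0..} h''"

definition L2_rv :: "'w measure \<Rightarrow> ('w \<Rightarrow> real) \<Rightarrow> bool" where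
  "L2_rv M X \<longleftrightarrow> X \<in> borel_measurable M \<and> integrable M (\<lambda>\<omega>. (X \<omega>)\<^sup>2)"

text \<open>\<open>X\<close> is a version of the mean-square directional derivative of the field \<open>F\<close> at \<open>x\<close>
  in direction \<open>v\<close>.\<close>

definition has_ms_derivative ::
    "'w measure \<Rightarrow> ('a::real_vector \<Rightarrow> 'w \<Rightarrow> real) \<Rightarrow> 'a \<Rightarrow> 'a \<Rightarrow> ('w \<Rightarrow> real) \<Rightarrow> bool" where
  "has_ms_derivative M F v x X \<longleftrightarrow>
     (\<forall>y. L2_rv M (F y)) \<and> L2_rv M X \<and>
     ((\<lambda>t::real. LINT \<omega>|M. ((F (x + t *\<^sub>R v) \<omega> - F x \<omega>) / t - X \<omega>)\<^sup>2) \<longlongrightarrow> 0) (at 0)"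

text \<open>A mean-square derivative is determined only up to almost sure equality; a version is
  chosen at every point, and covariances do not depend on the choice.\<close>

definition ms_deriv ::
    "'w measure \<Rightarrow> 'a::real_vector \<Rightarrow> ('a \<Rightarrow> 'w \<Rightarrow> real) \<Rightarrow> 'a \<Rightarrow> 'w \<Rightarrow> real" where
  "ms_deriv M v F x = (SOME X. has_ms_derivative M F v x X)"

definition dir1 :: "'d \<Rightarrow> (real^'d) \<times> (real^'d)" where
  "dir1 i = (axis i 1, 0)"

definition dir2 :: "'d \<Rightarrow> (real^'d) \<times> (real^'d)" where
  "dir2 i = (0, axis i 1)"

definition block_grad ::
    "'w measure \<Rightarrow> ((real^'d) \<times> (real^'d) \<Rightarrow> 'w \<Rightarrow> real) \<Rightarrow> (real^'d) \<times> (real^'d) \<Rightarrow>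
     'd \<Rightarrow> 'w \<Rightarrow> real" where
  "block_grad M f z i = ms_deriv M (dir1 i) f z"

definition block_hess11 ::
    "'w measure \<Rightarrow> ((real^'d) \<times> (real^'d) \<Rightarrow> 'w \<Rightarrow> real) \<Rightarrow> (real^'d) \<times> (real^'d) \<Rightarrow>
     'd \<Rightarrow> 'd \<Rightarrow> 'w \<Rightarrow> real" where
  "block_hess11 M f z i j = ms_deriv M (dir1 i) (ms_deriv M (dir1 j) f) z"

definition block_hess12 ::
    "'w measure \<Rightarrow> ((real^'d) \<times> (real^'d) \<Rightarrow> 'w \<Rightarrow> real) \<Rightarrow> (real^'d) \<times> (real^'d) \<Rightarrow>
     'd \<Rightarrow> 'd \<Rightarrow> 'w \<Rightarrow> real" where
  "block_hess12 M f z i j = ms_deriv M (dir1 i) (ms_deriv M (dir2 j) f) z"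

definition kronecker :: "'d \<Rightarrow> 'd \<Rightarrow> real" where
  "kronecker i j = (if i = j then 1 else 0)"

end

theory Submission
  imports Defs
begin

text \<open>A covariance of mean-square derivatives is a mixed partial derivative of the covariance
  function, so the theorem reduces to differentiating
  \<open>k\<^sub>f(x, y) = 2 \<Phi>(x - y) - 2 \<Phi>(x - y\<^sup>f\<^sup>l\<^sup>i\<^sup>p)\<close> with \<open>\<Phi> r = h(\<parallel>r\<parallel>\<^sup>2)\<close> at \<open>x = y = z\<close>, where both arguments of
  \<open>\<Phi>\<close> vanish because \<open>z\<close> is its own flip.

  The common tool for both halves is the mixed finite difference \<open>\<Delta>\<close> of order \<open>n\<close> in
  directions \<open>v\<^sub>1, \<dots>, v\<^sub>n\<close>. By the mean value theorem, applied once per direction, the quotient of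
  \<open>\<Delta>\<close> by the product of the step sizes is close to the iterated directional derivative, uniformly
  over all small step sizes (\<open>mixed_diff_approx_iter_deriv\<close>). On the probabilistic side the inner
  product of two difference quotients of a field is exactly such a quotient of its covariance
  (\<open>inner_diff_quot\<close>). Uniformity therefore makes the difference quotients Cauchy in \<open>L\<^sup>2\<close>, the
  derivative exists by completeness (\<open>ms_deriv_exists\<close>), and continuity of the inner product
  identifies its covariances (\<open>ms_derivative_inner\<close>). As the derivative field has itself a smooth
  covariance, the argument can be repeated for the second derivatives (\<open>ms_deriv2\<close>).

  On the analytic side \<open>h\<close> has only two derivatives, so the fourth derivative of \<open>\<Phi>\<close> at \<open>0\<close>
  cannot be computed by the chain rule. But \<open>\<Phi>\<close>, being a restriction of \<open>k\<^sub>u\<close>, is four times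
  continuously differentiable, and then its derivatives at \<open>0\<close> may be read off from any polynomial that
  agrees with it up to \<open>o(\<parallel>r\<parallel>\<^sup>4)\<close> (\<open>iter_deriv_at_0_eqI\<close>). The second order Taylor formula
  of \<open>h\<close> supplies that polynomial, and its fourth difference is the polarisation of \<open>\<parallel>r\<parallel>\<^sup>4\<close>,
  a sum over the three pairings of the directions (\<open>mixed_diff_4\<close>). For each of the two terms of
  \<open>k\<^sub>f\<close> this gives three products; the pairing that couples the two derivatives at \<open>x\<close> with
  each other cancels between the terms, and the remaining ones are the Kronecker deltas of the theorem.\<close>

section \<open>Iterated directional derivatives\<close>

definition dir_deriv :: "'a::euclidean_space \<Rightarrow> ('a \<Rightarrow> real) \<Rightarrow> 'a \<Rightarrow> real" where
  "dir_deriv v f x = frechet_derivative f (at x) v"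

primrec iter_deriv :: "'a::euclidean_space list \<Rightarrow> ('a \<Rightarrow> real) \<Rightarrow> 'a \<Rightarrow> real" where
  "iter_deriv [] f = f"
| "iter_deriv (v # vs) f = iter_deriv vs (dir_deriv v f)"

lemma Cn_Suc_dir_deriv:
  "Cn (Suc n) f \<longleftrightarrow> (\<forall>x. f differentiable at x) \<and> (\<forall>v. Cn n (dir_deriv v f))"
  by (simp add: dir_deriv_def[abs_def])

declare Cn.simps(2)[simp del]

lemma dir_deriv_eqI:
  "(f has_derivative f') (at x) \<Longrightarrow> dir_deriv v f x = f' v"
  unfolding dir_deriv_def using frechet_derivative_at by metis

lemma Cn_SucD: "Cn (Suc n) f \<Longrightarrow> Cn n f"
proof (induction n arbitrary: f)
  case 0
  then have "f differentiable_on UNIV"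
    by (simp add: Cn_Suc_dir_deriv differentiable_on_def)
  then show ?case by (simp add: differentiable_imp_continuous_on)
next
  case (Suc n)
  then show ?case by (metis Cn_Suc_dir_deriv)
qed

lemma Cn_has_derivative:
  assumes "Cn (Suc n) f"
  shows "(f has_derivative (\<lambda>v. dir_deriv v f x)) (at x)"
  using assms frechet_derivative_works[of f "at x"]
  by (simp add: Cn_Suc_dir_deriv dir_deriv_def)

text \<open>Regularity and the derivative formula are proved together because the induction for the former
  needs the latter.\<close>
lemma Cn_comp_linear:
  assumes "bounded_linear L" "Cn n f"
  shows "Cn n (\<lambda>x. f (L x))"
    and "0 < n \<Longrightarrow> dir_deriv v (\<lambda>x. f (L x)) = (\<lambda>x. dir_deriv (L v) f (L x))"
proof -
  have deriv: "((\<lambda>x. g (L x)) has_derivative (\<lambda>v. dir_deriv (L v) g (L x))) (at x)"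
    if "Cn (Suc m) g" for g m x
    using has_derivative_compose[OF bounded_linear.has_derivative[OF assms(1) has_derivative_ident]
        Cn_has_derivative[OF that, of "L x"]] by simp
  show "Cn n (\<lambda>x. f (L x))" using assms(2)
  proof (induction n arbitrary: f)
    case 0
    then show ?case
      using bounded_linear.continuous_on[OF assms(1) continuous_on_id]
      by (auto intro: continuous_on_compose2)
  next
    case (Suc n)
    have "dir_deriv v (\<lambda>x. f (L x)) = (\<lambda>x. dir_deriv (L v) f (L x))" for v
      using dir_deriv_eqI[OF deriv[OF Suc.prems]] by blast
    with Suc deriv[OF Suc.prems] show ?case
      by (auto simp: Cn_Suc_dir_deriv differentiable_def)
  qed
  show "dir_deriv v (\<lambda>x. f (L x)) = (\<lambda>x. dir_deriv (L v) f (L x))" if "0 < n"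
    using dir_deriv_eqI[OF deriv] assms(2) that by (cases n) blast+
qed

lemma Cn_lincomb:
  assumes "Cn n f" "Cn n g"
  shows "Cn n (\<lambda>x. a * f x + b * g x)"
    and "0 < n \<Longrightarrow> dir_deriv v (\<lambda>x. a * f x + b * g x)
      = (\<lambda>x. a * dir_deriv v f x + b * dir_deriv v g x)"
proof -
  have deriv: "((\<lambda>x. a * f x + b * g x) has_derivative
      (\<lambda>v. a * dir_deriv v f x + b * dir_deriv v g x)) (at x)"
    if "Cn (Suc m) f" "Cn (Suc m) g" for f g m x
    using Cn_has_derivative[OF that(1)] Cn_has_derivative[OF that(2)]
    by (auto intro!: derivative_eq_intros)
  show "Cn n (\<lambda>x. a * f x + b * g x)" using assms
  proof (induction n arbitrary: f g)
    case 0
    then show ?case by (auto intro!: continuous_intros)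
  next
    case (Suc n)
    have "dir_deriv v (\<lambda>x. a * f x + b * g x)
      = (\<lambda>x. a * dir_deriv v f x + b * dir_deriv v g x)" for v
      using dir_deriv_eqI[OF deriv[OF Suc.prems]] by blast
    with Suc deriv[OF Suc.prems] show ?case
      by (auto simp: Cn_Suc_dir_deriv differentiable_def)
  qed
  show "dir_deriv v (\<lambda>x. a * f x + b * g x)
      = (\<lambda>x. a * dir_deriv v f x + b * dir_deriv v g x)" if "0 < n"
    using dir_deriv_eqI[OF deriv] assms that by (cases n) blast+
qed

lemma Cn_iter_deriv: "Cn (length vs + n) f \<Longrightarrow> Cn n (iter_deriv vs f)"
  by (induction vs arbitrary: f) (auto simp: Cn_Suc_dir_deriv)

lemma iter_deriv_comp_linear:
  assumes "bounded_linear L" "Cn (length vs) f"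
  shows "iter_deriv vs (\<lambda>x. f (L x)) x = iter_deriv (map L vs) f (L x)"
  using assms(2)
proof (induction vs arbitrary: f)
  case (Cons v vs)
  then have "dir_deriv v (\<lambda>x. f (L x)) = (\<lambda>x. dir_deriv (L v) f (L x))"
    by (intro Cn_comp_linear(2)[OF assms(1)]) auto
  with Cons show ?case by (simp add: Cn_Suc_dir_deriv)
qed simp

lemma iter_deriv_lincomb:
  assumes "Cn (length vs) f" "Cn (length vs) g"
  shows "iter_deriv vs (\<lambda>x. a * f x + b * g x) x = a * iter_deriv vs f x + b * iter_deriv vs g x"
  using assms
proof (induction vs arbitrary: f g)
  case (Cons v vs)
  then have "dir_deriv v (\<lambda>x. a * f x + b * g x)
      = (\<lambda>x. a * dir_deriv v f x + b * dir_deriv v g x)"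
    by (intro Cn_lincomb(2)) auto
  with Cons show ?case by (simp add: Cn_Suc_dir_deriv)
qed simp

section \<open>Mixed finite differences\<close>

text \<open>The step sizes are kept apart from the directions so that \<open>map snd ps\<close> and
  \<open>prod_list (map fst ps)\<close> are the directions and the denominator of the difference quotient.\<close>
primrec mixed_diff :: "(real \<times> 'a::real_vector) list \<Rightarrow> ('a \<Rightarrow> real) \<Rightarrow> 'a \<Rightarrow> real" where
  "mixed_diff [] f x = f x"
| "mixed_diff (p # ps) f x = mixed_diff ps f (x + fst p *\<^sub>R snd p) - mixed_diff ps f x"

lemma mixed_diff_has_real_derivative:
  assumes "Cn (Suc n) f"
  shows "((\<lambda>s. mixed_diff ps f (x + s *\<^sub>R v)) has_real_derivative
    mixed_diff ps (dir_deriv v f) (x + s *\<^sub>R v)) (at s)"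
proof (induction ps arbitrary: x)
  case Nil
  have "((\<lambda>s. x + s *\<^sub>R v) has_vector_derivative v) (at s)"
    by (auto intro!: derivative_eq_intros)
  from vector_derivative_diff_chain_within[OF this has_derivative_at_withinI[OF
      Cn_has_derivative[OF assms, of "x + s *\<^sub>R v"]]]
  show ?case by (simp add: o_def has_real_derivative_iff_has_vector_derivative)
next
  case (Cons p ps)
  have "((\<lambda>s. mixed_diff ps f ((x + fst p *\<^sub>R snd p) + s *\<^sub>R v) - mixed_diff ps f (x + s *\<^sub>R v))
      has_real_derivative mixed_diff ps (dir_deriv v f) ((x + fst p *\<^sub>R snd p) + s *\<^sub>R v)
        - mixed_diff ps (dir_deriv v f) (x + s *\<^sub>R v)) (at s)"
    by (intro DERIV_diff Cons.IH)
  then show ?case by (simp add: ac_simps)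
qed

text \<open>A form of the mean value theorem that covers steps of either sign, as mean-square derivatives
  are two-sided limits.\<close>
lemma mvt_symmetric:
  fixes \<phi> :: "real \<Rightarrow> real"
  assumes "\<And>s. (\<phi> has_real_derivative \<phi>' s) (at s)"
  obtains \<xi> where "\<bar>\<xi>\<bar> \<le> \<bar>t\<bar>" "\<phi> t - \<phi> 0 = t * \<phi>' \<xi>"
proof (cases t "0::real" rule: linorder_cases)
  case less
  from MVT2[OF this assms] obtain \<xi> where "t < \<xi>" "\<xi> < 0" "\<phi> 0 - \<phi> t = (0 - t) * \<phi>' \<xi>"
    by blast
  then show ?thesis by (intro that[of \<xi>]) auto
next
  case greater
  from MVT2[OF this assms] obtain \<xi> where "0 < \<xi>" "\<xi> < t" "\<phi> t - \<phi> 0 = (t - 0) * \<phi>' \<xi>"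
    by blast
  then show ?thesis by (intro that[of \<xi>]) auto
qed (use that[of 0] in auto)

text \<open>One application of the mean value theorem turns the outermost difference into a derivative,
  which commutes with the remaining differences.\<close>
lemma mixed_diff_mean_value:
  assumes "Cn (length ps) f"
  shows "\<exists>y. norm (y - x) \<le> (\<Sum>(t, v)\<leftarrow>ps. \<bar>t\<bar> * norm v) \<and>
    mixed_diff ps f x = prod_list (map fst ps) * iter_deriv (map snd ps) f y"
  using assms
proof (induction ps arbitrary: f x)
  case Nil
  show ?case by (intro exI[of _ x]) simp
next
  case (Cons p ps)
  obtain t v where p: "p = (t, v)" by fastforce
  have C: "Cn (Suc (length ps)) f" using Cons.prems by simp
  obtain \<xi> where \<xi>: "\<bar>\<xi>\<bar> \<le> \<bar>t\<bar>" and
    eq: "mixed_diff ps f (x + t *\<^sub>R v) - mixed_diff ps f (x + 0 *\<^sub>R v)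
      = t * mixed_diff ps (dir_deriv v f) (x + \<xi> *\<^sub>R v)"
    using mvt_symmetric[OF mixed_diff_has_real_derivative[OF C]] by metis
  have "Cn (length ps) (dir_deriv v f)" using C by (simp add: Cn_Suc_dir_deriv)
  from Cons.IH[OF this, of "x + \<xi> *\<^sub>R v"] obtain y where
    y: "norm (y - (x + \<xi> *\<^sub>R v)) \<le> (\<Sum>(t, v)\<leftarrow>ps. \<bar>t\<bar> * norm v)"
    "mixed_diff ps (dir_deriv v f) (x + \<xi> *\<^sub>R v)
      = prod_list (map fst ps) * iter_deriv (map snd ps) (dir_deriv v f) y" by blast
  have "norm (y - x) \<le> norm (y - (x + \<xi> *\<^sub>R v)) + norm (\<xi> *\<^sub>R v)"
    using norm_triangle_ineq[of "y - (x + \<xi> *\<^sub>R v)" "\<xi> *\<^sub>R v"] by simp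
  also have "norm (\<xi> *\<^sub>R v) \<le> \<bar>t\<bar> * norm v" using \<xi> by (simp add: mult_right_mono)
  finally show ?case using y eq by (intro exI[of _ y]) (auto simp: p)
qed

text \<open>The steps vary independently of each other: existence of a mean-square derivative requires the
  limit of second differences along arbitrary pairs of small steps, not only along equal ones.\<close>
lemma mixed_diff_approx_iter_deriv:
  assumes "Cn (length vs) f" "e > 0"
  obtains d where "d > 0"
    "\<And>ps. map snd ps = vs \<Longrightarrow> (\<And>t. t \<in> fst ` set ps \<Longrightarrow> \<bar>t\<bar> < d \<and> t \<noteq> 0) \<Longrightarrow>
      \<bar>mixed_diff ps f x / prod_list (map fst ps) - iter_deriv vs f x\<bar> < e"
proof -
  have "continuous_on UNIV (iter_deriv vs f)"
    using Cn_iter_deriv[of vs 0 f] assms(1) by simp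
  then obtain r where r: "r > 0" "\<And>y. norm (y - x) < r \<Longrightarrow> \<bar>iter_deriv vs f y - iter_deriv vs f x\<bar> < e"
    using assms(2) unfolding continuous_on_iff dist_norm real_norm_def by (metis UNIV_I)
  define S where "S = (\<Sum>v\<leftarrow>vs. norm v)"
  have S: "S \<ge> 0" unfolding S_def by (intro sum_list_nonneg) auto
  \<comment> \<open>The intermediate point of the mean value theorem is within \<open>d * S\<close> of \<open>x\<close>; the \<open>+ 1\<close> covers \<open>S = 0\<close>.\<close>
  define d where "d = r / (S + 1)"
  have d: "d > 0" "d * S < r" using r(1) S by (auto simp: d_def field_simps)
  show ?thesis
  proof (rule that[OF d(1)])
    fix ps assume ps: "map snd ps = vs" "\<And>t. t \<in> fst ` set ps \<Longrightarrow> \<bar>t\<bar> < d \<and> t \<noteq> 0"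
    from mixed_diff_mean_value[of ps f x] ps(1) assms(1) obtain y where
      y: "norm (y - x) \<le> (\<Sum>(t, v)\<leftarrow>ps. \<bar>t\<bar> * norm v)"
        "mixed_diff ps f x = prod_list (map fst ps) * iter_deriv vs f y" by auto
    have "(\<Sum>(t, v)\<leftarrow>ps. \<bar>t\<bar> * norm v) \<le> (\<Sum>(t, v)\<leftarrow>ps. d * norm v)"
      using ps(2) by (intro sum_list_mono) (force intro!: mult_right_mono)
    also have "\<dots> = d * (\<Sum>v\<leftarrow>map snd ps. norm v)"
      by (simp add: sum_list_const_mult[symmetric] o_def case_prod_unfold)
    also have "\<dots> < r" using d(2) by (simp add: ps(1) S_def)
    finally have "norm (y - x) < r" using y(1) by simp
    moreover have "prod_list (map fst ps) \<noteq> 0" using ps(2) by (auto simp: prod_list_zero_iff)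
    ultimately show "\<bar>mixed_diff ps f x / prod_list (map fst ps) - iter_deriv vs f x\<bar> < e"
      using r(2) by (simp add: y(2))
  qed
qed

lemma mixed_diff_tendsto_iter_deriv:
  assumes "Cn (length vs) f"
  shows "((\<lambda>t. mixed_diff (map (Pair t) vs) f x / t ^ length vs) \<longlongrightarrow> iter_deriv vs f x) (at 0)"
proof (rule LIM_I)
  fix e :: real assume "e > 0"
  from mixed_diff_approx_iter_deriv[OF assms this, where x = x] obtain d where d: "d > 0"
    "\<And>ps. map snd ps = vs \<Longrightarrow> (\<And>t. t \<in> fst ` set ps \<Longrightarrow> \<bar>t\<bar> < d \<and> t \<noteq> 0) \<Longrightarrow>
      \<bar>mixed_diff ps f x / prod_list (map fst ps) - iter_deriv vs f x\<bar> < e" by blast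
  have "\<bar>mixed_diff (map (Pair t) vs) f x / t ^ length vs - iter_deriv vs f x\<bar> < e"
    if "t \<noteq> 0" "\<bar>t\<bar> < d" for t
    using d(2)[of "map (Pair t) vs"] that
    by (fastforce simp: o_def map_replicate_const)
  with d(1) show "\<exists>s>0. \<forall>t. t \<noteq> 0 \<and> norm (t - 0) < s \<longrightarrow>
      norm (mixed_diff (map (Pair t) vs) f x / t ^ length vs - iter_deriv vs f x) < e"
    by auto
qed

section \<open>Derivatives at the origin from polynomial approximation\<close>

lemma mixed_diff_add:
  "mixed_diff ps (\<lambda>x. f x + g x) x = mixed_diff ps f x + mixed_diff ps g x"
  by (induction ps arbitrary: x) auto

text \<open>The difference is evaluated at \<open>t *\<^sub>R r\<close> rather than at \<open>0\<close> since the induction shifts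
  the base point by multiples of \<open>t\<close>.\<close>
lemma mixed_diff_tendsto_zero:
  assumes "\<And>r. ((\<lambda>t. g (t *\<^sub>R r) / t ^ n) \<longlongrightarrow> 0) (at 0)"
  shows "((\<lambda>t. mixed_diff (map (Pair t) vs) g (t *\<^sub>R r) / t ^ n) \<longlongrightarrow> 0) (at 0)"
proof (induction vs arbitrary: r)
  case Nil
  then show ?case using assms by simp
next
  case (Cons v vs)
  have "((\<lambda>t. mixed_diff (map (Pair t) vs) g (t *\<^sub>R (r + v)) / t ^ n
      - mixed_diff (map (Pair t) vs) g (t *\<^sub>R r) / t ^ n) \<longlongrightarrow> 0 - 0) (at 0)"
    by (intro tendsto_diff Cons.IH)
  then show ?case by (simp add: scaleR_add_right diff_divide_distrib)
qed

text \<open>Differences of a function and of an approximation \<open>p\<close> have the same leading term, and for a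
  function known to be smooth this term is its derivative. No differentiability of the remainder is
  involved, which is what makes the lemma applicable to \<open>h(\<parallel>r\<parallel>\<^sup>2)\<close> with \<open>h\<close> only twice
  differentiable.\<close>
lemma iter_deriv_at_0_eqI:
  assumes n: "length vs = n" and f: "Cn n f"
    and approx: "\<And>r. ((\<lambda>t. (f (t *\<^sub>R r) - p (t *\<^sub>R r)) / t ^ n) \<longlongrightarrow> 0) (at 0)"
    and p: "\<And>t. mixed_diff (map (Pair t) vs) p 0 = t ^ n * c"
  shows "iter_deriv vs f 0 = c"
proof -
  have "((\<lambda>t. mixed_diff (map (Pair t) vs) (\<lambda>x. f x - p x) 0 / t ^ n) \<longlongrightarrow> 0) (at 0)"
    using mixed_diff_tendsto_zero[OF approx, where r = 0 and vs = vs] by simp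
  then have "((\<lambda>t. mixed_diff (map (Pair t) vs) (\<lambda>x. f x - p x) 0 / t ^ n + c)
      \<longlongrightarrow> 0 + c) (at 0)"
    by (intro tendsto_add tendsto_const)
  moreover have "mixed_diff (map (Pair t) vs) (\<lambda>x. f x - p x) 0 / t ^ n + c
      = mixed_diff (map (Pair t) vs) f 0 / t ^ n" if "t \<noteq> 0" for t
  proof -
    have "mixed_diff (map (Pair t) vs) f 0
        = mixed_diff (map (Pair t) vs) (\<lambda>x. f x - p x) 0 + t ^ n * c"
      using mixed_diff_add[of "map (Pair t) vs" "\<lambda>x. f x - p x" p 0] by (simp add: p)
    then show ?thesis using that by (simp add: add_divide_distrib)
  qed
  then have "\<forall>\<^sub>F t in at 0. mixed_diff (map (Pair t) vs) (\<lambda>x. f x - p x) 0 / t ^ n + c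
      = mixed_diff (map (Pair t) vs) f 0 / t ^ n"
    unfolding eventually_at_filter by (intro always_eventually allI impI)
  ultimately have "((\<lambda>t. mixed_diff (map (Pair t) vs) f 0 / t ^ n) \<longlongrightarrow> 0 + c) (at 0)"
    by (rule Lim_transform_eventually)
  then have "((\<lambda>t. mixed_diff (map (Pair t) vs) f 0 / t ^ n) \<longlongrightarrow> c) (at 0)"
    by simp
  then show ?thesis
    by (rule tendsto_unique[OF trivial_limit_at mixed_diff_tendsto_iter_deriv[of vs f 0, unfolded n, OF f]])
qed

text \<open>The exponent \<open>m\<close> is a variable of its own so that the rule unifies with numerals.\<close>
lemma tendsto_at_0_square_arg:
  fixes g :: "real \<Rightarrow> real"
  assumes "((\<lambda>\<tau>. g \<tau> / \<tau> ^ n) \<longlongrightarrow> 0) (at 0 within {0..})" "g 0 = 0" "n > 0"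
    and m: "m = 2 * n"
  shows "((\<lambda>t. g ((norm (t *\<^sub>R r))\<^sup>2) / t ^ m) \<longlongrightarrow> 0) (at 0)"
proof (cases "r = 0")
  case True
  then show ?thesis using assms by simp
next
  case False
  have "filterlim (\<lambda>t::real. (norm (t *\<^sub>R r))\<^sup>2) (at 0 within {0..}) (at 0)"
    unfolding filterlim_at using False
    by (auto intro!: tendsto_eq_intros simp: eventually_at_filter)
  from filterlim_compose[OF assms(1) this]
  have "((\<lambda>t::real. (norm r)\<^sup>2 ^ n * (g ((norm (t *\<^sub>R r))\<^sup>2) / (norm (t *\<^sub>R r))\<^sup>2 ^ n))
      \<longlongrightarrow> (norm r)\<^sup>2 ^ n * 0) (at 0)"
    by (intro tendsto_mult tendsto_const)
  moreover have "(norm r)\<^sup>2 ^ n * (g ((norm (t *\<^sub>R r))\<^sup>2) / (norm (t *\<^sub>R r))\<^sup>2 ^ n)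
      = g ((norm (t *\<^sub>R r))\<^sup>2) / t ^ (2 * n)" for t
    using False by (simp add: power_mult_distrib power_mult)
  ultimately show ?thesis by (simp add: m)
qed

lemma first_order_remainder:
  fixes h :: "real \<Rightarrow> real"
  assumes "(h has_real_derivative a) (at 0 within {0..})"
  shows "((\<lambda>\<tau>. (h \<tau> - (h 0 + a * \<tau>)) / \<tau> ^ 1) \<longlongrightarrow> 0) (at 0 within {0..})"
proof -
  have "((\<lambda>\<tau>. (h \<tau> - h 0) / (\<tau> - 0) - a) \<longlongrightarrow> a - a) (at 0 within {0..})"
    using assms unfolding has_field_derivative_iff by (intro tendsto_diff tendsto_const)
  moreover have "\<forall>\<^sub>F \<tau> in at 0 within {0..}. (h \<tau> - h 0) / (\<tau> - 0) - a = (h \<tau> - (h 0 + a * \<tau>)) / \<tau> ^ 1"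
    by (simp add: eventually_at_filter field_simps)
  ultimately have "((\<lambda>\<tau>. (h \<tau> - (h 0 + a * \<tau>)) / \<tau> ^ 1) \<longlongrightarrow> a - a) (at 0 within {0..})"
    by (rule Lim_transform_eventually)
  then show ?thesis by simp
qed

text \<open>Taylor's formula at the left end of the domain: the mean value theorem bounds the remainder
  by \<open>\<tau>\<close> times the remainder of the linear approximation of \<open>h'\<close>, taken at an
  intermediate point.\<close>
lemma second_order_remainder:
  fixes h h' :: "real \<Rightarrow> real"
  assumes h: "\<And>t. t \<ge> 0 \<Longrightarrow> (h has_real_derivative h' t) (at t within {0..})"
    and h': "(h' has_real_derivative b) (at 0 within {0..})"
  shows "((\<lambda>\<tau>. (h \<tau> - (h 0 + h' 0 * \<tau> + b / 2 * \<tau>\<^sup>2)) / \<tau> ^ 2) \<longlongrightarrow> 0) (at 0 within {0..})"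
  unfolding Lim_within
proof (intro allI impI)
  fix e :: real assume e: "e > 0"
  have "\<exists>d>0. \<forall>s\<in>{0..}. 0 < dist s 0 \<and> dist s 0 < d \<longrightarrow>
      dist ((h' s - (h' 0 + b * s)) / s ^ 1) 0 < e"
    using first_order_remainder[OF h'] e unfolding Lim_within by blast
  then obtain d where d: "d > 0" "\<And>s. s > 0 \<Longrightarrow> s < d \<Longrightarrow> \<bar>(h' s - (h' 0 + b * s)) / s\<bar> < e"
    unfolding dist_norm real_norm_def diff_zero power_one_right
    by (metis abs_of_pos atLeast_iff less_imp_le)
  define \<phi> where "\<phi> \<tau> = h \<tau> - (h 0 + h' 0 * \<tau> + b / 2 * \<tau>\<^sup>2)" for \<tau>
  have "\<bar>\<phi> \<tau> / \<tau> ^ 2\<bar> < e" if \<tau>: "0 < \<tau>" "\<tau> < d" for \<tau>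
  proof -
    have "(\<phi> has_derivative (\<lambda>x. x * (h' s - (h' 0 + b * s)))) (at s within {0..\<tau>})"
      if "0 \<le> s" "s \<le> \<tau>" for s
    proof -
      have "(h has_real_derivative h' s) (at s within {0..\<tau>})"
        by (rule DERIV_subset[OF h]) (use that in auto)
      then have "(\<phi> has_real_derivative h' s - (h' 0 + b * s)) (at s within {0..\<tau>})"
        unfolding \<phi>_def by (auto intro!: derivative_eq_intros)
      then show ?thesis by (simp add: has_field_derivative_def mult_commute_abs)
    qed
    from mvt_simple[OF \<tau>(1) this] obtain \<xi> where \<xi>: "0 < \<xi>" "\<xi> < \<tau>"
      "\<phi> \<tau> - \<phi> 0 = (\<tau> - 0) * (h' \<xi> - (h' 0 + b * \<xi>))" by auto
    have "\<bar>\<phi> \<tau>\<bar> = \<tau> * (\<xi> * \<bar>(h' \<xi> - (h' 0 + b * \<xi>)) / \<xi>\<bar>)"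
      using \<xi> \<tau> by (simp add: \<phi>_def abs_mult abs_divide)
    also have "\<dots> < \<tau> * (\<xi> * e)"
      using d(2)[of \<xi>] \<xi> \<tau> by (intro mult_strict_left_mono) auto
    also have "\<dots> \<le> \<tau> * (\<tau> * e)" using \<xi> \<tau> e by simp
    finally have "\<bar>\<phi> \<tau>\<bar> < e * \<tau>\<^sup>2" by (simp add: power2_eq_square ac_simps)
    then show ?thesis using \<tau> by (simp add: abs_divide pos_divide_less_eq)
  qed
  then have "dist (\<phi> \<tau> / \<tau> ^ 2) 0 < e" if "\<tau> \<in> {0..}" "0 < dist \<tau> 0 \<and> dist \<tau> 0 < d" for \<tau>
    using that by (simp add: dist_real_def)
  with d(1) show "\<exists>d>0. \<forall>\<tau>\<in>{0..}. 0 < dist \<tau> 0 \<and> dist \<tau> 0 < d \<longrightarrow>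
      dist ((h \<tau> - (h 0 + h' 0 * \<tau> + b / 2 * \<tau>\<^sup>2)) / \<tau> ^ 2) 0 < e"
    unfolding \<phi>_def by (intro exI[of _ d] conjI ballI impI)
qed

lemma mixed_diff_2:
  "mixed_diff [(t, a), (t, b)] (\<lambda>x. c0 + c1 * (norm x)\<^sup>2) 0 = t ^ 2 * (2 * c1 * (a \<bullet> b))"
  unfolding power2_norm_eq_inner mixed_diff.simps fst_conv snd_conv inner_add_left inner_add_right inner_scaleR_left
    inner_scaleR_right inner_zero_left inner_zero_right add_0_left inner_commute[of b a]
  by (simp add: algebra_simps power2_eq_square)

text \<open>The fourth difference of the quartic form \<open>(x \<bullet> x)\<^sup>2\<close> is \<open>4!\<close> times its polarisation, the
  average over the three pairings of the four directions. The quadratic part contributes nothing.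
  Taking one difference at a time at a general base point keeps the polynomial identities small, as
  each step lowers the degree.\<close>
lemma mixed_diff_4:
  "mixed_diff [(t, a), (t, b), (t, c), (t, d)] (\<lambda>x. c0 + c1 * (norm x)\<^sup>2 + c2 * ((norm x)\<^sup>2)\<^sup>2) 0
    = t ^ 4 * (8 * c2 * ((a \<bullet> b) * (c \<bullet> d) + (a \<bullet> c) * (b \<bullet> d) + (a \<bullet> d) * (b \<bullet> c)))"
proof -
  define P where "P x = c0 + c1 * (x \<bullet> x) + c2 * (x \<bullet> x)\<^sup>2" for x :: 'a
  define A B C D where "A = t *\<^sub>R a" and "B = t *\<^sub>R b" and "C = t *\<^sub>R c" and "D = t *\<^sub>R d"
  note expand = inner_add_left inner_add_right
  have 1: "mixed_diff [(t, d)] P x = c1 * (2 * (x \<bullet> D) + D \<bullet> D)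
      + c2 * ((2 * (x \<bullet> D) + D \<bullet> D) * (2 * (x \<bullet> x) + 2 * (x \<bullet> D) + D \<bullet> D))" for x
    unfolding mixed_diff.simps fst_conv snd_conv D_def[symmetric] P_def expand inner_commute[of D x]
    by algebra
  have 2: "mixed_diff [(t, c), (t, d)] P x = c1 * (2 * (C \<bullet> D)) + c2 * (4 * (x \<bullet> x) * (C \<bullet> D)
      + 8 * (x \<bullet> C) * (x \<bullet> D) + 8 * (x \<bullet> C) * (C \<bullet> D) + 8 * (x \<bullet> D) * (C \<bullet> D)
      + 4 * (x \<bullet> C) * (D \<bullet> D) + 4 * (x \<bullet> D) * (C \<bullet> C)
      + 2 * (C \<bullet> C) * (D \<bullet> D) + 4 * (C \<bullet> D) * (C \<bullet> D)
      + 4 * (C \<bullet> C) * (C \<bullet> D) + 4 * (D \<bullet> D) * (C \<bullet> D))" for x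
    unfolding mixed_diff.simps(2)[of "(t, c)"] fst_conv snd_conv C_def[symmetric] 1 expand
      inner_commute[of C x]
    by algebra
  have 3: "mixed_diff [(t, b), (t, c), (t, d)] P x = c2 * (
      8 * ((x \<bullet> B) * (C \<bullet> D) + (x \<bullet> C) * (B \<bullet> D) + (x \<bullet> D) * (B \<bullet> C))
      + 4 * (B \<bullet> B + B \<bullet> C + B \<bullet> D) * (C \<bullet> D) + 4 * (B \<bullet> C + C \<bullet> C + C \<bullet> D) * (B \<bullet> D)
      + 4 * (B \<bullet> D + C \<bullet> D + D \<bullet> D) * (B \<bullet> C))" for x
    unfolding mixed_diff.simps(2)[of "(t, b)"] fst_conv snd_conv B_def[symmetric] 2 expand
      inner_commute[of B x]
    by (simp add: algebra_simps)
  have "mixed_diff [(t, a), (t, b), (t, c), (t, d)] P 0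
      = c2 * (8 * ((A \<bullet> B) * (C \<bullet> D) + (A \<bullet> C) * (B \<bullet> D) + (A \<bullet> D) * (B \<bullet> C)))"
    unfolding mixed_diff.simps(2)[of "(t, a)"] fst_conv snd_conv A_def[symmetric] 3 expand
      inner_zero_left add_0_left
    by (simp add: algebra_simps)
  also have "\<dots> = t ^ 4 * (8 * c2 * ((a \<bullet> b) * (c \<bullet> d) + (a \<bullet> c) * (b \<bullet> d) + (a \<bullet> d) * (b \<bullet> c)))"
    unfolding A_def B_def C_def D_def inner_scaleR_left inner_scaleR_right by algebra
  finally show ?thesis unfolding P_def power2_norm_eq_inner .
qed

section \<open>Square integrable random variables\<close>

lemma L2_rv_measurable: "L2_rv M X \<Longrightarrow> X \<in> borel_measurable M"
  by (simp add: L2_rv_def)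

lemma L2_rv_mult_integrable:
  assumes X: "L2_rv M X" and Y: "L2_rv M Y"
  shows "integrable M (\<lambda>\<omega>. X \<omega> * Y \<omega>)"
proof (rule Bochner_Integration.integrable_bound)
  show "integrable M (\<lambda>\<omega>. (X \<omega>)\<^sup>2 + (Y \<omega>)\<^sup>2)" using assms by (simp add: L2_rv_def)
  show "(\<lambda>\<omega>. X \<omega> * Y \<omega>) \<in> borel_measurable M" using assms[THEN L2_rv_measurable] by measurable
  have "\<bar>x * y\<bar> \<le> x\<^sup>2 + y\<^sup>2" for x y :: real
  proof -
    have "2 * \<bar>x * y\<bar> \<le> x\<^sup>2 + y\<^sup>2"
      using sum_squares_bound[of "\<bar>x\<bar>" "\<bar>y\<bar>"] by (simp add: abs_mult mult.assoc)
    then show ?thesis using abs_ge_zero[of "x * y"] by linarith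
  qed
  then show "AE \<omega> in M. norm (X \<omega> * Y \<omega>) \<le> norm ((X \<omega>)\<^sup>2 + (Y \<omega>)\<^sup>2)" by simp
qed

lemma L2_rv_lincomb:
  assumes "L2_rv M X" "L2_rv M Y"
  shows "L2_rv M (\<lambda>\<omega>. a * X \<omega> + b * Y \<omega>)"
proof -
  have "(\<lambda>\<omega>. (a * X \<omega> + b * Y \<omega>)\<^sup>2)
      = (\<lambda>\<omega>. a\<^sup>2 * (X \<omega> * X \<omega>) + 2 * a * b * (X \<omega> * Y \<omega>) + b\<^sup>2 * (Y \<omega> * Y \<omega>))"
    by (simp add: power2_eq_square algebra_simps)
  moreover have "integrable M \<dots>"
    using assms by (intro Bochner_Integration.integrable_add integrable_mult_right L2_rv_mult_integrable)
  moreover have "(\<lambda>\<omega>. a * X \<omega> + b * Y \<omega>) \<in> borel_measurable M"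
    using assms[THEN L2_rv_measurable] by measurable
  ultimately show ?thesis by (simp add: L2_rv_def)
qed

lemma L2_rv_diff: "L2_rv M X \<Longrightarrow> L2_rv M Y \<Longrightarrow> L2_rv M (\<lambda>\<omega>. X \<omega> - Y \<omega>)"
  by (drule (1) L2_rv_lincomb[where a = 1 and b = "-1"]) simp

lemma L2_rv_diff_quot: "L2_rv M X \<Longrightarrow> L2_rv M Y \<Longrightarrow> L2_rv M (\<lambda>\<omega>. (X \<omega> - Y \<omega>) / t)"
  by (drule (1) L2_rv_lincomb[where a = "1 / t" and b = "- 1 / t"]) (simp add: diff_divide_distrib)

lemma (in prob_space) L2_rv_const: "L2_rv M (\<lambda>_. c)"
  by (simp add: L2_rv_def)

lemma (in prob_space) L2_rv_integrable: "L2_rv M X \<Longrightarrow> integrable M X"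
  using L2_rv_mult_integrable[of M X "\<lambda>_. 1"] L2_rv_const[of 1] by simp

lemma integral_square_lincomb:
  assumes "L2_rv M X" "L2_rv M Y"
  shows "(LINT \<omega>|M. (a * X \<omega> + b * Y \<omega>)\<^sup>2) = a\<^sup>2 * (LINT \<omega>|M. (X \<omega>)\<^sup>2)
    + 2 * a * b * (LINT \<omega>|M. X \<omega> * Y \<omega>) + b\<^sup>2 * (LINT \<omega>|M. (Y \<omega>)\<^sup>2)"
proof -
  have "(\<lambda>\<omega>. (a * X \<omega> + b * Y \<omega>)\<^sup>2)
      = (\<lambda>\<omega>. a\<^sup>2 * (X \<omega>)\<^sup>2 + 2 * a * b * (X \<omega> * Y \<omega>) + b\<^sup>2 * (Y \<omega>)\<^sup>2)"
    by (simp add: power2_eq_square algebra_simps)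
  then show ?thesis
    using assms L2_rv_mult_integrable[OF assms] by (simp add: L2_rv_def)
qed

text \<open>The quadratic form \<open>(a, b) \<mapsto> E (a X + b Y)\<^sup>2\<close> is nonnegative, so its determinant is.\<close>
lemma L2_Cauchy_Schwarz:
  assumes "L2_rv M X" "L2_rv M Y"
  shows "\<bar>LINT \<omega>|M. X \<omega> * Y \<omega>\<bar>
    \<le> sqrt (LINT \<omega>|M. (X \<omega>)\<^sup>2) * sqrt (LINT \<omega>|M. (Y \<omega>)\<^sup>2)"
proof -
  define A B D where "A = (LINT \<omega>|M. (X \<omega>)\<^sup>2)" and "B = (LINT \<omega>|M. X \<omega> * Y \<omega>)"
    and "D = (LINT \<omega>|M. (Y \<omega>)\<^sup>2)"
  have nonneg: "a\<^sup>2 * A + 2 * a * b * B + b\<^sup>2 * D \<ge> 0" for a b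
    unfolding A_def B_def D_def integral_square_lincomb[OF assms, symmetric]
    by (intro integral_nonneg_AE) auto
  have "B\<^sup>2 \<le> A * D"
  proof (cases "D = 0")
    case False
    have "D \<ge> 0" unfolding D_def by (intro integral_nonneg_AE) auto
    \<comment> \<open>Up to scaling, \<open>(D, - B)\<close> minimises the form for a given first coefficient.\<close>
    moreover have "D * (A * D - B\<^sup>2) \<ge> 0"
      using nonneg[of D "-B"] by (simp add: power2_eq_square algebra_simps)
    ultimately show ?thesis using False by (simp add: zero_le_mult_iff)
  next
    case True
    have "B = 0"
    proof (rule ccontr)
      assume "B \<noteq> 0"
      then show False using nonneg[of 1 "- (A + 1) / (2 * B)"] True by (simp add: field_simps)
    qed
    then show ?thesis using True by simp
  qed
  then have "sqrt (B\<^sup>2) \<le> sqrt (A * D)" by (rule real_sqrt_le_mono)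
  then show ?thesis by (simp add: real_sqrt_mult A_def B_def D_def)
qed

text \<open>Expand both factors around their limits and estimate the three error terms by Cauchy-Schwarz.\<close>
lemma L2_inner_tendsto:
  assumes Q: "\<And>t. L2_rv M (Q t)" and X: "L2_rv M X"
    and R: "\<And>t. L2_rv M (R t)" and Y: "L2_rv M Y"
    and QX: "((\<lambda>t. LINT \<omega>|M. (Q t \<omega> - X \<omega>)\<^sup>2) \<longlongrightarrow> 0) F"
    and RY: "((\<lambda>t. LINT \<omega>|M. (R t \<omega> - Y \<omega>)\<^sup>2) \<longlongrightarrow> 0) F"
  shows "((\<lambda>t. LINT \<omega>|M. Q t \<omega> * R t \<omega>) \<longlongrightarrow> (LINT \<omega>|M. X \<omega> * Y \<omega>)) F"
proof -
  define q r where "q t = sqrt (LINT \<omega>|M. (Q t \<omega> - X \<omega>)\<^sup>2)"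
    and "r t = sqrt (LINT \<omega>|M. (R t \<omega> - Y \<omega>)\<^sup>2)" for t
  define x y where "x = sqrt (LINT \<omega>|M. (X \<omega>)\<^sup>2)" and "y = sqrt (LINT \<omega>|M. (Y \<omega>)\<^sup>2)"
  note dQ = L2_rv_diff[OF Q X] and dR = L2_rv_diff[OF R Y]
  have "((\<lambda>t. q t * r t + q t * y + x * r t) \<longlongrightarrow> sqrt 0 * sqrt 0 + sqrt 0 * y + x * sqrt 0) F"
    unfolding q_def r_def by (intro tendsto_intros QX RY)
  then have lim: "((\<lambda>t. q t * r t + q t * y + x * r t) \<longlongrightarrow> 0) F" by simp
  have bound: "\<bar>(LINT \<omega>|M. Q t \<omega> * R t \<omega>) - (LINT \<omega>|M. X \<omega> * Y \<omega>)\<bar>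
      \<le> q t * r t + q t * y + x * r t" for t
  proof -
    have "(\<lambda>\<omega>. Q t \<omega> * R t \<omega>) = (\<lambda>\<omega>. (Q t \<omega> - X \<omega>) * (R t \<omega> - Y \<omega>)
        + (Q t \<omega> - X \<omega>) * Y \<omega> + X \<omega> * (R t \<omega> - Y \<omega>) + X \<omega> * Y \<omega>)"
      by (simp add: algebra_simps)
    then have "(LINT \<omega>|M. Q t \<omega> * R t \<omega>) - (LINT \<omega>|M. X \<omega> * Y \<omega>)
      = (LINT \<omega>|M. (Q t \<omega> - X \<omega>) * (R t \<omega> - Y \<omega>))
        + (LINT \<omega>|M. (Q t \<omega> - X \<omega>) * Y \<omega>) + (LINT \<omega>|M. X \<omega> * (R t \<omega> - Y \<omega>))"
      using L2_rv_mult_integrable[OF dQ dR] L2_rv_mult_integrable[OF dQ Y]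
        L2_rv_mult_integrable[OF X dR] L2_rv_mult_integrable[OF X Y] by simp
    then show ?thesis
      using L2_Cauchy_Schwarz[OF dQ[of t] dR[of t]] L2_Cauchy_Schwarz[OF dQ[of t] Y]
        L2_Cauchy_Schwarz[OF X dR[of t]] unfolding q_def r_def x_def y_def by linarith
  qed
  show ?thesis
    by (rule LIM_zero_cancel, rule Lim_null_comparison[OF _ lim]) (use bound in auto)
qed

text \<open>Over a probability space an \<open>L\<^sup>2\<close> Cauchy sequence is Cauchy in \<open>L\<^sup>1\<close> and hence has an almost
  everywhere convergent subsequence. Its limit is the \<open>L\<^sup>2\<close> limit by Fatou's lemma.\<close>
lemma (in prob_space) L2_Riesz_Fischer:
  assumes S: "\<And>n. L2_rv M (S n)"
    and Cauchy: "\<And>e. e > 0 \<Longrightarrow> \<exists>N. \<forall>m\<ge>N. \<forall>n\<ge>N. (LINT \<omega>|M. (S m \<omega> - S n \<omega>)\<^sup>2) < e"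
  obtains X where "L2_rv M X" "(\<lambda>n. LINT \<omega>|M. (S n \<omega> - X \<omega>)\<^sup>2) \<longlonglongrightarrow> 0"
proof -
  note [measurable] = L2_rv_measurable[OF S]
  have L1: "\<exists>N. \<forall>m\<ge>N. \<forall>n\<ge>N. (LINT \<omega>|M. norm (S m \<omega> - S n \<omega>)) < e" if "e > 0" for e
  proof -
    obtain N where N: "\<And>m n. m \<ge> N \<Longrightarrow> n \<ge> N \<Longrightarrow> (LINT \<omega>|M. (S m \<omega> - S n \<omega>)\<^sup>2) < e\<^sup>2"
      using Cauchy[OF zero_less_power[OF \<open>e > 0\<close>]] by blast
    have "(LINT \<omega>|M. norm (S m \<omega> - S n \<omega>)) < e" if "m \<ge> N" "n \<ge> N" for m n
    proof -
      have "L2_rv M (\<lambda>\<omega>. \<bar>S m \<omega> - S n \<omega>\<bar>)"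
        using L2_rv_diff[OF S S, of m n] by (simp add: L2_rv_def)
      from L2_Cauchy_Schwarz[OF this L2_rv_const[of 1]]
      have "(LINT \<omega>|M. norm (S m \<omega> - S n \<omega>)) \<le> sqrt (LINT \<omega>|M. (S m \<omega> - S n \<omega>)\<^sup>2)"
        by (simp add: prob_space)
      also have "\<dots> < sqrt (e\<^sup>2)" using N[OF that] by (rule real_sqrt_less_mono)
      finally show ?thesis using \<open>e > 0\<close> by simp
    qed
    then show ?thesis by blast
  qed
  obtain r where r: "strict_mono r" "AE \<omega> in M. Cauchy (\<lambda>i. S (r i) \<omega>)"
    using cauchy_L1_AE_cauchy_subseq[of M S, OF L2_rv_integrable[OF S] L1] by blast
  define X where "X \<omega> = lim (\<lambda>i. S (r i) \<omega>)" for \<omega>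
  have [measurable]: "X \<in> borel_measurable M"
    unfolding X_def by measurable
  have conv: "AE \<omega> in M. (\<lambda>i. S (r i) \<omega>) \<longlonglongrightarrow> X \<omega>"
    using r(2) by eventually_elim (simp add: X_def convergent_LIMSEQ_iff[symmetric] real_Cauchy_convergent)
  have Fatou: "(\<integral>\<^sup>+\<omega>. ennreal ((S n \<omega> - X \<omega>)\<^sup>2) \<partial>M) \<le> ennreal e"
    if N: "\<And>m. m \<ge> N \<Longrightarrow> (LINT \<omega>|M. (S n \<omega> - S m \<omega>)\<^sup>2) < e" for n N e
  proof -
    have "(\<integral>\<^sup>+\<omega>. ennreal ((S n \<omega> - X \<omega>)\<^sup>2) \<partial>M)
        = (\<integral>\<^sup>+\<omega>. liminf (\<lambda>i. ennreal ((S n \<omega> - S (r i) \<omega>)\<^sup>2)) \<partial>M)"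
    proof (rule nn_integral_cong_AE, use conv in eventually_elim)
      fix \<omega> assume "(\<lambda>i. S (r i) \<omega>) \<longlonglongrightarrow> X \<omega>"
      then have "(\<lambda>i. ennreal ((S n \<omega> - S (r i) \<omega>)\<^sup>2)) \<longlonglongrightarrow> ennreal ((S n \<omega> - X \<omega>)\<^sup>2)"
        by (intro tendsto_intros)
      then show "ennreal ((S n \<omega> - X \<omega>)\<^sup>2) = liminf (\<lambda>i. ennreal ((S n \<omega> - S (r i) \<omega>)\<^sup>2))"
        by (rule lim_imp_Liminf[OF sequentially_bot, symmetric])
    qed
    also have "\<dots> \<le> liminf (\<lambda>i. \<integral>\<^sup>+\<omega>. ennreal ((S n \<omega> - S (r i) \<omega>)\<^sup>2) \<partial>M)"
      by (intro nn_integral_liminf) measurable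
    also have "\<dots> \<le> liminf (\<lambda>i::nat. ennreal e)"
    proof (intro Liminf_mono eventually_sequentiallyI)
      fix i assume "N \<le> i"
      then have "(LINT \<omega>|M. (S n \<omega> - S (r i) \<omega>)\<^sup>2) < e"
        using seq_suble[OF r(1), of i] by (intro N) simp
      then show "(\<integral>\<^sup>+\<omega>. ennreal ((S n \<omega> - S (r i) \<omega>)\<^sup>2) \<partial>M) \<le> ennreal e"
        using L2_rv_diff[OF S S, of n "r i"]
        by (subst nn_integral_eq_integral) (auto simp: L2_rv_def intro!: ennreal_leI)
    qed
    finally show ?thesis by (simp add: Liminf_const)
  qed
  have L2_diff: "L2_rv M (\<lambda>\<omega>. S n \<omega> - X \<omega>)" and small: "(LINT \<omega>|M. (S n \<omega> - X \<omega>)\<^sup>2) \<le> e"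
    if "\<And>m. m \<ge> N \<Longrightarrow> (LINT \<omega>|M. (S n \<omega> - S m \<omega>)\<^sup>2) < e" "e > 0" for n N e
  proof -
    have "integrable M (\<lambda>\<omega>. (S n \<omega> - X \<omega>)\<^sup>2)"
      using Fatou[OF that(1)] by (intro integrableI_bounded) (auto simp: less_top[symmetric] top_unique)
    then show "L2_rv M (\<lambda>\<omega>. S n \<omega> - X \<omega>)" by (simp add: L2_rv_def)
    show "(LINT \<omega>|M. (S n \<omega> - X \<omega>)\<^sup>2) \<le> e"
      using Fatou[OF that(1)] that(2) by (subst integral_eq_nn_integral) (auto intro!: enn2real_leI)
  qed
  show ?thesis
  proof (rule that)
    obtain N where "\<forall>m\<ge>N. \<forall>n\<ge>N. (LINT \<omega>|M. (S m \<omega> - S n \<omega>)\<^sup>2) < 1"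
      using Cauchy[OF zero_less_one] by blast
    then have "L2_rv M (\<lambda>\<omega>. S N \<omega> - X \<omega>)"
      by (intro L2_diff[of N N 1]) auto
    from L2_rv_diff[OF S[of N] this] show "L2_rv M X" by simp
    show "(\<lambda>n. LINT \<omega>|M. (S n \<omega> - X \<omega>)\<^sup>2) \<longlonglongrightarrow> 0"
    proof (rule LIMSEQ_I)
      fix e :: real assume "e > 0"
      then have "e / 2 > 0" by simp
      from Cauchy[OF this] obtain N where
        N: "\<forall>m\<ge>N. \<forall>n\<ge>N. (LINT \<omega>|M. (S m \<omega> - S n \<omega>)\<^sup>2) < e / 2" by blast
      then have "(LINT \<omega>|M. (S n \<omega> - X \<omega>)\<^sup>2) \<le> e / 2" if "n \<ge> N" for n
        using that \<open>e > 0\<close> by (intro small[of N]) auto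
      moreover have "(LINT \<omega>|M. (S n \<omega> - X \<omega>)\<^sup>2) \<ge> 0" for n
        by (intro integral_nonneg_AE) auto
      ultimately have "norm ((LINT \<omega>|M. (S n \<omega> - X \<omega>)\<^sup>2) - 0) < e" if "n \<ge> N" for n
        unfolding diff_zero real_norm_def using that \<open>e > 0\<close> by (fastforce simp: abs_of_nonneg)
      then show "\<exists>N. \<forall>n\<ge>N. norm ((LINT \<omega>|M. (S n \<omega> - X \<omega>)\<^sup>2) - 0) < e" by blast
    qed
  qed
qed

text \<open>Loeve's criterion: convergence of all inner products \<open>E (Q\<^sub>s Q\<^sub>t)\<close> to one number \<open>L\<close> makes
  \<open>Q\<close> Cauchy, since \<open>E (Q\<^sub>s - Q\<^sub>t)\<^sup>2\<close> then tends to \<open>L - 2 L + L\<close>.\<close>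
lemma (in prob_space) L2_limit_at_0:
  fixes Q :: "real \<Rightarrow> 'a \<Rightarrow> real"
  assumes Q: "\<And>t. L2_rv M (Q t)"
    and L: "\<And>e. e > 0 \<Longrightarrow> \<exists>d>0. \<forall>s t. s \<noteq> 0 \<and> \<bar>s\<bar> < d \<and> t \<noteq> 0 \<and> \<bar>t\<bar> < d \<longrightarrow>
      \<bar>(LINT \<omega>|M. Q s \<omega> * Q t \<omega>) - L\<bar> < e"
  obtains X where "L2_rv M X" "((\<lambda>t. LINT \<omega>|M. (Q t \<omega> - X \<omega>)\<^sup>2) \<longlongrightarrow> 0) (at 0)"
proof -
  have Cauchy: "\<exists>d>0. \<forall>s t. s \<noteq> 0 \<and> \<bar>s\<bar> < d \<and> t \<noteq> 0 \<and> \<bar>t\<bar> < d \<longrightarrow>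
      (LINT \<omega>|M. (Q s \<omega> - Q t \<omega>)\<^sup>2) < e" if "e > 0" for e
  proof -
    from that have "e / 4 > 0" by simp
    from L[OF this] obtain d where d: "d > 0"
      "\<And>s t. s \<noteq> 0 \<Longrightarrow> \<bar>s\<bar> < d \<Longrightarrow> t \<noteq> 0 \<Longrightarrow> \<bar>t\<bar> < d \<Longrightarrow>
        \<bar>(LINT \<omega>|M. Q s \<omega> * Q t \<omega>) - L\<bar> < e / 4" by blast
    have "(LINT \<omega>|M. (Q s \<omega> - Q t \<omega>)\<^sup>2) < e"
      if "s \<noteq> 0" "\<bar>s\<bar> < d" "t \<noteq> 0" "\<bar>t\<bar> < d" for s t
    proof -
      have "(LINT \<omega>|M. (Q s \<omega> - Q t \<omega>)\<^sup>2) = (LINT \<omega>|M. Q s \<omega> * Q s \<omega>)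
          - 2 * (LINT \<omega>|M. Q s \<omega> * Q t \<omega>) + (LINT \<omega>|M. Q t \<omega> * Q t \<omega>)"
        using integral_square_lincomb[OF Q[of s] Q[of t], of 1 "-1"]
        by (simp add: power2_eq_square)
      moreover have "\<bar>(LINT \<omega>|M. Q s \<omega> * Q s \<omega>) - L\<bar> < e / 4"
        "\<bar>(LINT \<omega>|M. Q s \<omega> * Q t \<omega>) - L\<bar> < e / 4" "\<bar>(LINT \<omega>|M. Q t \<omega> * Q t \<omega>) - L\<bar> < e / 4"
        by (intro d(2) that)+
      ultimately show ?thesis unfolding abs_less_iff by linarith
    qed
    with d(1) show ?thesis by blast
  qed
  define \<tau> where "\<tau> n = inverse (real (Suc n))" for n
  have \<tau>: "\<tau> n \<noteq> 0" "\<tau> \<longlonglongrightarrow> 0" for n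
    unfolding \<tau>_def using LIMSEQ_inverse_real_of_nat by (auto simp del: of_nat_Suc)
  have \<tau>_small: "\<forall>\<^sub>F n in sequentially. \<bar>\<tau> n\<bar> < d" if "d > 0" for d
    using tendstoD[OF \<tau>(2) that] by simp
  have "\<exists>N. \<forall>m\<ge>N. \<forall>n\<ge>N. (LINT \<omega>|M. (Q (\<tau> m) \<omega> - Q (\<tau> n) \<omega>)\<^sup>2) < e" if e: "e > 0" for e
  proof -
    obtain d where "d > 0" and d: "\<And>s t. s \<noteq> 0 \<Longrightarrow> \<bar>s\<bar> < d \<Longrightarrow> t \<noteq> 0 \<Longrightarrow> \<bar>t\<bar> < d \<Longrightarrow>
      (LINT \<omega>|M. (Q s \<omega> - Q t \<omega>)\<^sup>2) < e" using Cauchy[OF e] by blast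
    with \<tau>_small[of d] \<tau>(1) show ?thesis unfolding eventually_sequentially by metis
  qed
  then obtain X where X: "L2_rv M X" "(\<lambda>n. LINT \<omega>|M. (Q (\<tau> n) \<omega> - X \<omega>)\<^sup>2) \<longlonglongrightarrow> 0"
    by (rule L2_Riesz_Fischer[of "\<lambda>n. Q (\<tau> n)", OF Q])
  have "((\<lambda>t. LINT \<omega>|M. (Q t \<omega> - X \<omega>)\<^sup>2) \<longlongrightarrow> 0) (at 0)"
  proof (rule LIM_I)
    fix e :: real assume "e > 0"
    then have "e / 4 > 0" by simp
    from Cauchy[OF this] obtain d where d: "d > 0"
      "\<And>s t. s \<noteq> 0 \<Longrightarrow> \<bar>s\<bar> < d \<Longrightarrow> t \<noteq> 0 \<Longrightarrow> \<bar>t\<bar> < d \<Longrightarrow>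
        (LINT \<omega>|M. (Q s \<omega> - Q t \<omega>)\<^sup>2) < e / 4" by blast
    have "\<forall>\<^sub>F n in sequentially. \<bar>\<tau> n\<bar> < d \<and> (LINT \<omega>|M. (Q (\<tau> n) \<omega> - X \<omega>)\<^sup>2) < e / 4"
      using \<tau>_small[OF d(1)] order_tendstoD(2)[OF X(2), of "e / 4"] \<open>e > 0\<close>
      by (intro eventually_conj) auto
    then obtain n where n: "\<bar>\<tau> n\<bar> < d" "(LINT \<omega>|M. (Q (\<tau> n) \<omega> - X \<omega>)\<^sup>2) < e / 4"
      by (auto simp: eventually_sequentially)
    have "norm ((LINT \<omega>|M. (Q t \<omega> - X \<omega>)\<^sup>2) - 0) < e" if "t \<noteq> 0" "\<bar>t\<bar> < d" for t
    proof -
      have ineq: "(Q t \<omega> - X \<omega>)\<^sup>2 \<le> 2 * (Q t \<omega> - Q (\<tau> n) \<omega>)\<^sup>2 + 2 * (Q (\<tau> n) \<omega> - X \<omega>)\<^sup>2" for \<omega>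
        using sum_squares_bound[of "Q t \<omega> - Q (\<tau> n) \<omega>" "Q (\<tau> n) \<omega> - X \<omega>"]
        by (simp add: power2_eq_square algebra_simps)
      have "(LINT \<omega>|M. (Q t \<omega> - X \<omega>)\<^sup>2)
          \<le> (LINT \<omega>|M. 2 * (Q t \<omega> - Q (\<tau> n) \<omega>)\<^sup>2 + 2 * (Q (\<tau> n) \<omega> - X \<omega>)\<^sup>2)"
        using L2_rv_diff[OF Q[of t] X(1)] L2_rv_diff[OF Q[of t] Q[of "\<tau> n"]]
          L2_rv_diff[OF Q[of "\<tau> n"] X(1)]
        by (intro integral_mono ineq) (auto simp: L2_rv_def)
      also have "\<dots> = 2 * (LINT \<omega>|M. (Q t \<omega> - Q (\<tau> n) \<omega>)\<^sup>2) + 2 * (LINT \<omega>|M. (Q (\<tau> n) \<omega> - X \<omega>)\<^sup>2)"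
        using L2_rv_diff[OF Q[of t] Q[of "\<tau> n"]] L2_rv_diff[OF Q[of "\<tau> n"] X(1)]
        by (simp add: L2_rv_def)
      also have "\<dots> < e" using d(2)[of t "\<tau> n"] n \<tau>(1) that by simp
      finally show ?thesis by (simp add: integral_nonneg_AE)
    qed
    with d(1) show "\<exists>s>0. \<forall>t. t \<noteq> 0 \<and> norm (t - 0) < s \<longrightarrow>
        norm ((LINT \<omega>|M. (Q t \<omega> - X \<omega>)\<^sup>2) - 0) < e" by auto
  qed
  with X(1) that show ?thesis by blast
qed

section \<open>Mean-square derivatives of a field with smooth covariance\<close>

definition centered_L2_field :: "'w measure \<Rightarrow> ('a \<Rightarrow> 'w \<Rightarrow> real) \<Rightarrow> bool" where
  "centered_L2_field M F \<longleftrightarrow> (\<forall>x. L2_rv M (F x) \<and> (LINT \<omega>|M. F x \<omega>) = 0)"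

lemma centered_L2_fieldD:
  assumes "centered_L2_field M F"
  shows "L2_rv M (F x)" "(LINT \<omega>|M. F x \<omega>) = 0"
  using assms unfolding centered_L2_field_def by blast+

text \<open>By bilinearity the four products are the four corners of the second difference of the
  covariance, taken once in the first and once in the second argument.\<close>
lemma inner_diff_quot:
  assumes F: "\<And>a. L2_rv M (F a)" and G: "\<And>b. L2_rv M (G b)"
    and cov: "\<And>a b. (LINT \<omega>|M. F a \<omega> * G b \<omega>) = C (a, b)"
  shows "(LINT \<omega>|M. ((F (x + s *\<^sub>R v) \<omega> - F x \<omega>) / s) * ((G (y + t *\<^sub>R w) \<omega> - G y \<omega>) / t))
    = mixed_diff [(s, (v, 0)), (t, (0, w))] C (x, y) / (s * t)"
proof -
  note int = L2_rv_mult_integrable[OF F G]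
  have "(\<lambda>\<omega>. ((F (x + s *\<^sub>R v) \<omega> - F x \<omega>) / s) * ((G (y + t *\<^sub>R w) \<omega> - G y \<omega>) / t))
    = (\<lambda>\<omega>. ((F (x + s *\<^sub>R v) \<omega> * G (y + t *\<^sub>R w) \<omega> - F (x + s *\<^sub>R v) \<omega> * G y \<omega>)
      - (F x \<omega> * G (y + t *\<^sub>R w) \<omega> - F x \<omega> * G y \<omega>)) / (s * t))"
    by (simp add: algebra_simps)
  then show ?thesis using int by (simp add: cov)
qed

text \<open>Two different fields are admitted so that the lemma also covers the second derivatives, which
  arise by differentiating two different first order derivative fields.\<close>
lemma ms_derivative_inner:
  fixes C :: "'a::euclidean_space \<times> 'a \<Rightarrow> real"
  assumes X: "has_ms_derivative M F v x X" and Y: "has_ms_derivative M G w y Y"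
    and cov: "\<And>a b. (LINT \<omega>|M. F a \<omega> * G b \<omega>) = C (a, b)" and C: "Cn 2 C"
  shows "(LINT \<omega>|M. X \<omega> * Y \<omega>) = iter_deriv [(v, 0), (0, w)] C (x, y)"
proof -
  have L2: "L2_rv M (F a)" "L2_rv M (G a)" "L2_rv M X" "L2_rv M Y" for a
    using X Y by (auto simp: has_ms_derivative_def)
  have lim1: "((\<lambda>t. LINT \<omega>|M. ((F (x + t *\<^sub>R v) \<omega> - F x \<omega>) / t) * ((G (y + t *\<^sub>R w) \<omega> - G y \<omega>) / t))
      \<longlongrightarrow> (LINT \<omega>|M. X \<omega> * Y \<omega>)) (at 0)"
    using X Y unfolding has_ms_derivative_def
    by (intro L2_inner_tendsto[where Q = "\<lambda>t \<omega>. (F (x + t *\<^sub>R v) \<omega> - F x \<omega>) / t"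
          and R = "\<lambda>t \<omega>. (G (y + t *\<^sub>R w) \<omega> - G y \<omega>) / t"] L2_rv_diff_quot L2) auto
  have eq: "(LINT \<omega>|M. ((F (x + t *\<^sub>R v) \<omega> - F x \<omega>) / t) * ((G (y + t *\<^sub>R w) \<omega> - G y \<omega>) / t))
      = mixed_diff (map (Pair t) [(v, 0), (0, w)]) C (x, y) / t ^ length [(v, 0), (0, w)]" for t
    using inner_diff_quot[of M F G C, OF L2(1) L2(2) cov, of x t v y t w] by (simp add: power2_eq_square)
  have lim2: "((\<lambda>t. mixed_diff (map (Pair t) [(v, 0), (0, w)]) C (x, y) / t ^ length [(v, 0), (0, w)])
      \<longlongrightarrow> iter_deriv [(v, 0), (0, w)] C (x, y)) (at 0)"
    using C by (intro mixed_diff_tendsto_iter_deriv) (simp add: numeral_2_eq_2)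
  show ?thesis
    by (rule tendsto_unique[OF trivial_limit_at lim1[unfolded eq] lim2])
qed

context prob_space
begin

text \<open>This justifies the choice made in \<^const>\<open>ms_deriv\<close>: every property of the chosen version is
  derived from it.\<close>
lemma ms_deriv_exists:
  fixes C :: "'b::euclidean_space \<times> 'b \<Rightarrow> real"
  assumes F: "\<And>a. L2_rv M (F a)"
    and cov: "\<And>a b. (LINT \<omega>|M. F a \<omega> * F b \<omega>) = C (a, b)" and C: "Cn 2 C"
  shows "has_ms_derivative M F v x (ms_deriv M v F x)"
proof -
  define Q where "Q t \<omega> = (F (x + t *\<^sub>R v) \<omega> - F x \<omega>) / t" for t \<omega>
  have Q: "L2_rv M (Q t)" for t
    unfolding Q_def by (intro L2_rv_diff_quot F)
  have QQ: "(LINT \<omega>|M. Q s \<omega> * Q t \<omega>) = mixed_diff [(s, (v, 0)), (t, (0, v))] C (x, x) / (s * t)" for s t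
    unfolding Q_def by (rule inner_diff_quot[of M F F C, OF F F cov])
  have C': "Cn (length [(v, 0), (0, v)]) C" using C by (simp add: numeral_2_eq_2)
  have "\<exists>d>0. \<forall>s t. s \<noteq> 0 \<and> \<bar>s\<bar> < d \<and> t \<noteq> 0 \<and> \<bar>t\<bar> < d \<longrightarrow>
      \<bar>(LINT \<omega>|M. Q s \<omega> * Q t \<omega>) - iter_deriv [(v, 0), (0, v)] C (x, x)\<bar> < e" if e: "e > 0" for e
  proof -
    from mixed_diff_approx_iter_deriv[OF C' e, where x = "(x, x)"] obtain d where d: "d > 0"
      "\<And>ps. map snd ps = [(v, 0), (0, v)] \<Longrightarrow> (\<And>t. t \<in> fst ` set ps \<Longrightarrow> \<bar>t\<bar> < d \<and> t \<noteq> 0) \<Longrightarrow>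
        \<bar>mixed_diff ps C (x, x) / prod_list (map fst ps) - iter_deriv [(v, 0), (0, v)] C (x, x)\<bar> < e"
      by blast
    have "\<bar>(LINT \<omega>|M. Q s \<omega> * Q t \<omega>) - iter_deriv [(v, 0), (0, v)] C (x, x)\<bar> < e"
      if st: "s \<noteq> 0 \<and> \<bar>s\<bar> < d \<and> t \<noteq> 0 \<and> \<bar>t\<bar> < d" for s t
    proof -
      have "\<bar>mixed_diff [(s, (v, 0)), (t, (0, v))] C (x, x)
          / prod_list (map fst [(s, (v, 0::'b)), (t, (0, v))]) - iter_deriv [(v, 0), (0, v)] C (x, x)\<bar> < e"
        by (rule d(2)) (use st in auto)
      then show ?thesis by (simp only: QQ list.map fst_conv prod_list.Cons prod_list.Nil mult_1_right)
    qed
    with d(1) show ?thesis by blast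
  qed
  then obtain X where "L2_rv M X" "((\<lambda>t. LINT \<omega>|M. (Q t \<omega> - X \<omega>)\<^sup>2) \<longlongrightarrow> 0) (at 0)"
    by (rule L2_limit_at_0[of Q, OF Q])
  then have "has_ms_derivative M F v x X"
    using F by (simp add: has_ms_derivative_def Q_def)
  then show ?thesis unfolding ms_deriv_def by (rule someI[of "has_ms_derivative M F v x"])
qed

lemma ms_deriv_centered_L2_field:
  fixes C :: "'b::euclidean_space \<times> 'b \<Rightarrow> real"
  assumes F: "centered_L2_field M F"
    and cov: "\<And>a b. (LINT \<omega>|M. F a \<omega> * F b \<omega>) = C (a, b)" and C: "Cn 2 C"
  shows "centered_L2_field M (ms_deriv M v F)"
  unfolding centered_L2_field_def
proof (intro allI conjI)
  fix x
  have L2: "L2_rv M (F a)" and mean: "(LINT \<omega>|M. F a \<omega>) = 0" for a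
    using F by (auto simp: centered_L2_field_def)
  note D = ms_deriv_exists[of F C, OF L2 cov C, of v x]
  then show L2': "L2_rv M (ms_deriv M v F x)" by (simp add: has_ms_derivative_def)
  have lim: "((\<lambda>t. LINT \<omega>|M. ((F (x + t *\<^sub>R v) \<omega> - F x \<omega>) / t) * 1)
      \<longlongrightarrow> (LINT \<omega>|M. ms_deriv M v F x \<omega> * 1)) (at 0)"
    using D unfolding has_ms_derivative_def
    by (intro L2_inner_tendsto[where Q = "\<lambda>t \<omega>. (F (x + t *\<^sub>R v) \<omega> - F x \<omega>) / t"
          and R = "\<lambda>_ _. 1"] L2_rv_diff_quot L2 L2' L2_rv_const) auto
  have zero: "(LINT \<omega>|M. ((F (x + t *\<^sub>R v) \<omega> - F x \<omega>) / t) * 1) = 0" for t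
    using L2_rv_integrable[OF L2] by (simp add: mean)
  from lim have "((\<lambda>t::real. 0) \<longlongrightarrow> (LINT \<omega>|M. ms_deriv M v F x \<omega>)) (at 0)"
    unfolding zero by simp
  from tendsto_unique[OF trivial_limit_at this tendsto_const]
  show "(LINT \<omega>|M. ms_deriv M v F x \<omega>) = 0" .
qed

lemma ms_deriv_inner:
  fixes C :: "'b::euclidean_space \<times> 'b \<Rightarrow> real"
  assumes F: "\<And>a. L2_rv M (F a)"
    and cov: "\<And>a b. (LINT \<omega>|M. F a \<omega> * F b \<omega>) = C (a, b)" and C: "Cn 2 C"
  shows "(LINT \<omega>|M. ms_deriv M v F x \<omega> * ms_deriv M w F y \<omega>) = iter_deriv [(v, 0), (0, w)] C (x, y)"
  by (rule ms_derivative_inner[of M F v x _ F w y _ C, OF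
        ms_deriv_exists[of F C, OF F cov C] ms_deriv_exists[of F C, OF F cov C] cov C])

text \<open>In \<open>iter_deriv\<close> the inner derivatives come first, because the covariance of the first order
  derivative fields is what the outer derivatives act on.\<close>
lemma ms_deriv2:
  fixes C :: "'b::euclidean_space \<times> 'b \<Rightarrow> real"
  assumes F: "centered_L2_field M F"
    and cov: "\<And>a b. (LINT \<omega>|M. F a \<omega> * F b \<omega>) = C (a, b)" and C: "Cn 4 C"
  shows "centered_L2_field M (ms_deriv M v (ms_deriv M w F))"
    and "(LINT \<omega>|M. ms_deriv M a (ms_deriv M b F) x \<omega> * ms_deriv M c (ms_deriv M d F) y \<omega>)
      = iter_deriv [(b, 0), (0, d), (a, 0), (0, c)] C (x, y)"
proof -
  have C2: "Cn 2 C"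
    using C Cn_SucD[of 2 C] Cn_SucD[of 3 C] by (simp add: eval_nat_numeral)
  have C_iter: "Cn 2 (iter_deriv [(v, 0), (0, w)] C)" for v w :: 'b
    by (rule Cn_iter_deriv) (use C in \<open>simp add: eval_nat_numeral\<close>)
  have L2: "L2_rv M (F a)" for a
    using F by (auto simp: centered_L2_field_def)
  have cov': "(LINT \<omega>|M. ms_deriv M v F x \<omega> * ms_deriv M w F y \<omega>)
      = iter_deriv [(v, 0), (0, w)] C (x, y)" for v w x y
    by (rule ms_deriv_inner[of F C, OF L2 cov C2])
  have field: "centered_L2_field M (ms_deriv M v F)" for v
    by (rule ms_deriv_centered_L2_field[of F C, OF F cov C2])
  then have L2': "L2_rv M (ms_deriv M v F a)" for v a
    by (auto simp: centered_L2_field_def)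
  show "centered_L2_field M (ms_deriv M v (ms_deriv M w F))"
    by (rule ms_deriv_centered_L2_field[of "ms_deriv M w F" "iter_deriv [(w, 0), (0, w)] C",
          OF field cov' C_iter])
  have exists: "has_ms_derivative M (ms_deriv M w F) v x (ms_deriv M v (ms_deriv M w F) x)" for v w x
    by (rule ms_deriv_exists[of "ms_deriv M w F" "iter_deriv [(w, 0), (0, w)] C",
          OF L2' cov' C_iter])
  have "(LINT \<omega>|M. ms_deriv M a (ms_deriv M b F) x \<omega> * ms_deriv M c (ms_deriv M d F) y \<omega>)
      = iter_deriv [(a, 0), (0, c)] (iter_deriv [(b, 0), (0, d)] C) (x, y)"
    by (rule ms_derivative_inner[of M "ms_deriv M b F" a x _ "ms_deriv M d F" c y _
          "iter_deriv [(b, 0), (0, d)] C", OF exists exists cov' C_iter])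
  then show "(LINT \<omega>|M. ms_deriv M a (ms_deriv M b F) x \<omega> * ms_deriv M c (ms_deriv M d F) y \<omega>)
      = iter_deriv [(b, 0), (0, d), (a, 0), (0, c)] C (x, y)"
    by simp
qed

lemma gaussian_rv_L2:
  assumes "gaussian_rv M X"
  shows "L2_rv M X"
proof -
  have meas: "X \<in> borel_measurable M" using assms by (simp add: gaussian_rv_def)
  from assms consider (normal) \<mu> \<sigma> where "\<sigma> > 0"
      "distributed M lborel X (\<lambda>x. ennreal (normal_density \<mu> \<sigma> x))"
    | (const) c where "AE \<omega> in M. X \<omega> = c"
    unfolding gaussian_rv_def by blast
  then have "integrable M (\<lambda>\<omega>. (X \<omega>)\<^sup>2)"
  proof cases
    case normal
    have "integrable M (\<lambda>\<omega>. (X \<omega> - \<mu>)\<^sup>2)"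
      using distributed_integrable[OF normal(2), of "\<lambda>x. (x - \<mu>)\<^sup>2"]
        integrable_normal_moment[OF normal(1), of \<mu> 2] by simp
    then have "L2_rv M (\<lambda>\<omega>. X \<omega> - \<mu>)" using meas by (simp add: L2_rv_def)
    from L2_rv_diff[OF this L2_rv_const[of "- \<mu>"]] show ?thesis by (simp add: L2_rv_def)
  next
    case const
    have "integrable M (\<lambda>\<omega>. (X \<omega>)\<^sup>2) \<longleftrightarrow> integrable M (\<lambda>_. c\<^sup>2)"
      by (rule integrable_cong_AE) (use meas const in auto)
    then show ?thesis by simp
  qed
  with meas show ?thesis by (simp add: L2_rv_def)
qed

end

lemma covariance_centered:
  "(LINT \<omega>|M. X \<omega>) = 0 \<Longrightarrow> (LINT \<omega>|M. Y \<omega>) = 0 \<Longrightarrow> covariance M X Y = (LINT \<omega>|M. X \<omega> * Y \<omega>)"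
  by (simp add: covariance_def)

section \<open>Derivatives of a radial function at the origin\<close>

lemma iter_deriv_radial_2:
  fixes a b :: "'a::euclidean_space"
  assumes "Cn 2 (\<lambda>r::'a. h ((norm r)\<^sup>2))" and h: "(h has_real_derivative c) (at 0 within {0..})"
  shows "iter_deriv [a, b] (\<lambda>r. h ((norm r)\<^sup>2)) 0 = 2 * c * (a \<bullet> b)"
proof (rule iter_deriv_at_0_eqI[where n = 2 and p = "\<lambda>r. h 0 + c * (norm r)\<^sup>2"])
  show "((\<lambda>t. (h ((norm (t *\<^sub>R r))\<^sup>2) - (h 0 + c * (norm (t *\<^sub>R r))\<^sup>2)) / t ^ 2) \<longlongrightarrow> 0) (at 0)"
    for r :: 'a
    by (rule tendsto_at_0_square_arg[OF first_order_remainder[OF h]]) auto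
  show "mixed_diff (map (Pair t) [a, b]) (\<lambda>r. h 0 + c * (norm r)\<^sup>2) 0
      = t ^ 2 * (2 * c * (a \<bullet> b))" for t
    unfolding list.map by (rule mixed_diff_2)
qed (use assms in auto)

text \<open>Up to \<open>o(\<parallel>r\<parallel>\<^sup>4)\<close> the function is \<open>h(0) + h'(0) \<parallel>r\<parallel>\<^sup>2 + h''(0) \<parallel>r\<parallel>\<^sup>4 / 2\<close>, of which the
  fourth difference sees the last term only.\<close>
lemma iter_deriv_radial_4:
  fixes v1 v2 v3 v4 :: "'a::euclidean_space"
  assumes "Cn 4 (\<lambda>r::'a. h ((norm r)\<^sup>2))"
    and h: "\<And>t. t \<ge> 0 \<Longrightarrow> (h has_real_derivative h' t) (at t within {0..})"
    and h': "(h' has_real_derivative c) (at 0 within {0..})"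
  shows "iter_deriv [v1, v2, v3, v4] (\<lambda>r. h ((norm r)\<^sup>2)) 0
    = 4 * c * ((v1 \<bullet> v2) * (v3 \<bullet> v4) + (v1 \<bullet> v3) * (v2 \<bullet> v4) + (v1 \<bullet> v4) * (v2 \<bullet> v3))"
proof (rule iter_deriv_at_0_eqI[where n = 4
      and p = "\<lambda>r. h 0 + h' 0 * (norm r)\<^sup>2 + c / 2 * ((norm r)\<^sup>2)\<^sup>2"])
  show "((\<lambda>t. (h ((norm (t *\<^sub>R r))\<^sup>2) - (h 0 + h' 0 * (norm (t *\<^sub>R r))\<^sup>2
        + c / 2 * ((norm (t *\<^sub>R r))\<^sup>2)\<^sup>2)) / t ^ 4) \<longlongrightarrow> 0) (at 0)" for r :: 'a
    by (rule tendsto_at_0_square_arg[OF second_order_remainder[OF h h']]) auto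
  show "mixed_diff (map (Pair t) [v1, v2, v3, v4])
        (\<lambda>r. h 0 + h' 0 * (norm r)\<^sup>2 + c / 2 * ((norm r)\<^sup>2)\<^sup>2) 0
      = t ^ 4 * (4 * c * ((v1 \<bullet> v2) * (v3 \<bullet> v4) + (v1 \<bullet> v3) * (v2 \<bullet> v4)
        + (v1 \<bullet> v4) * (v2 \<bullet> v3)))" for t
    unfolding list.map mixed_diff_4 by simp
qed (use assms in auto)

section \<open>The covariance of a block isotropic field\<close>

lemma norm_swap: "norm (prod.swap x) = norm x"
  by (cases x) (simp add: norm_Pair add.commute)

lemma swap_0: "prod.swap (0 :: 'a::zero \<times> 'b::zero) = 0"
  by (simp add: zero_prod_def)

lemma inner_swap: "prod.swap x \<bullet> prod.swap y = x \<bullet> y"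
  by (simp add: prod.swap_def inner_prod_def add.commute)

lemma bounded_linear_swap: "bounded_linear (prod.swap :: 'a::real_normed_vector \<times> 'b::real_normed_vector \<Rightarrow> _)"
  unfolding prod.swap_def by (intro bounded_linear_Pair bounded_linear_fst bounded_linear_snd)

definition block_cov :: "(real \<Rightarrow> real) \<Rightarrow> ('b::euclidean_space \<times> 'b) \<times> ('b \<times> 'b) \<Rightarrow> real" where
  "block_cov h p = 2 * h ((norm (fst p - snd p))\<^sup>2) - 2 * h ((norm (fst p - prod.swap (snd p)))\<^sup>2)"

text \<open>On the diagonal \<open>x = y = (s, s)\<close> both linear arguments vanish, so only derivatives of the radial
  function at \<open>0\<close> enter.\<close>
lemma block_cov:
  assumes \<Phi>: "Cn n (\<lambda>r::'b::euclidean_space \<times> 'b. h ((norm r)\<^sup>2))"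
  shows Cn_block_cov: "Cn n (block_cov h :: ('b \<times> 'b) \<times> ('b \<times> 'b) \<Rightarrow> real)"
    and iter_deriv_block_cov: "length vs = n \<Longrightarrow> iter_deriv vs (block_cov h) ((s, s), (s, s))
      = 2 * iter_deriv (map (\<lambda>v. fst v - snd v) vs) (\<lambda>r::'b \<times> 'b. h ((norm r)\<^sup>2)) 0
        - 2 * iter_deriv (map (\<lambda>v. fst v - prod.swap (snd v)) vs) (\<lambda>r. h ((norm r)\<^sup>2)) 0"
proof -
  define L1 L2 :: "('b \<times> 'b) \<times> ('b \<times> 'b) \<Rightarrow> 'b \<times> 'b"
    where "L1 = (\<lambda>p. fst p - snd p)" and "L2 = (\<lambda>p. fst p - prod.swap (snd p))"
  have lin: "bounded_linear L1" "bounded_linear L2"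
    unfolding L1_def L2_def
    by (intro bounded_linear_sub bounded_linear_fst bounded_linear_snd
        bounded_linear_compose[OF bounded_linear_swap])+
  note C1 = Cn_comp_linear(1)[OF lin(1) \<Phi>] and C2 = Cn_comp_linear(1)[OF lin(2) \<Phi>]
  have eq: "block_cov h = (\<lambda>p. 2 * h ((norm (L1 p))\<^sup>2) + (-2) * h ((norm (L2 p))\<^sup>2))"
    by (auto simp: block_cov_def L1_def L2_def)
  show "Cn n (block_cov h :: ('b \<times> 'b) \<times> ('b \<times> 'b) \<Rightarrow> real)"
    unfolding eq by (rule Cn_lincomb(1)[OF C1 C2])
  assume len: "length vs = n"
  have at_0: "L1 ((s, s), (s, s)) = 0" "L2 ((s, s), (s, s)) = 0"
    by (simp_all add: L1_def L2_def zero_prod_def)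
  have "iter_deriv vs (block_cov h) ((s, s), (s, s))
      = 2 * iter_deriv (map L1 vs) (\<lambda>r. h ((norm r)\<^sup>2)) 0
        + (-2) * iter_deriv (map L2 vs) (\<lambda>r. h ((norm r)\<^sup>2)) 0"
    unfolding eq iter_deriv_lincomb[OF C1[folded len] C2[folded len]]
      iter_deriv_comp_linear[OF lin(1) \<Phi>[folded len]]
      iter_deriv_comp_linear[OF lin(2) \<Phi>[folded len]] at_0 ..
  then show "iter_deriv vs (block_cov h) ((s, s), (s, s))
      = 2 * iter_deriv (map (\<lambda>v. fst v - snd v) vs) (\<lambda>r::'b \<times> 'b. h ((norm r)\<^sup>2)) 0
        - 2 * iter_deriv (map (\<lambda>v. fst v - prod.swap (snd v)) vs) (\<lambda>r. h ((norm r)\<^sup>2)) 0"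
    by (simp add: L1_def L2_def)
qed

text \<open>Of the four terms of the bilinear expansion two and two agree, because the flip is an isometric
  involution and \<open>u\<close> is isotropic.\<close>
lemma (in prob_space) block_field_covariance:
  fixes u :: "'b::euclidean_space \<times> 'b \<Rightarrow> 'a \<Rightarrow> real"
  assumes u: "centered_isotropic_gaussian_field M u h"
  shows "centered_L2_field M (block_field u)"
    and "(LINT \<omega>|M. block_field u x \<omega> * block_field u y \<omega>) = block_cov h (x, y)"
proof -
  have L2: "L2_rv M (u x)" for x
  proof (rule gaussian_rv_L2)
    have "\<forall>I c. finite I \<longrightarrow> gaussian_rv M (\<lambda>\<omega>. \<Sum>x\<in>I. c x * u x \<omega>)"
      using u by (simp add: centered_isotropic_gaussian_field_def gaussian_field_def)
    from this[rule_format, of "{x}" "\<lambda>_. 1"] show "gaussian_rv M (u x)" by simp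
  qed
  have mean: "(LINT \<omega>|M. u x \<omega>) = 0" for x
    using u unfolding centered_isotropic_gaussian_field_def by blast
  have "cov_fun M u (x, y) = h ((norm (x - y))\<^sup>2)" for x y
    using u unfolding centered_isotropic_gaussian_field_def by blast
  then have cov: "(LINT \<omega>|M. u x \<omega> * u y \<omega>) = h ((norm (x - y))\<^sup>2)" for x y
    by (simp only: cov_fun_def prod.case covariance_centered mean)
  show "centered_L2_field M (block_field u)"
    using L2_rv_integrable[OF L2]
    by (simp add: centered_L2_field_def block_field_def[abs_def] L2_rv_diff L2 mean)
  have swap_both: "norm (prod.swap x - prod.swap y) = norm (x - y)"
    and swap_left: "norm (prod.swap x - y) = norm (x - prod.swap y)" for x y :: "'b \<times> 'b"
    using norm_swap[of "x - y"] norm_swap[of "x - prod.swap y"]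
    by (simp_all add: prod.swap_def fst_diff snd_diff minus_prod_def)
  have "(\<lambda>\<omega>. block_field u x \<omega> * block_field u y \<omega>)
      = (\<lambda>\<omega>. (u x \<omega> * u y \<omega> - u x \<omega> * u (prod.swap y) \<omega>)
        - (u (prod.swap x) \<omega> * u y \<omega> - u (prod.swap x) \<omega> * u (prod.swap y) \<omega>))"
    by (simp add: block_field_def algebra_simps)
  then show "(LINT \<omega>|M. block_field u x \<omega> * block_field u y \<omega>) = block_cov h (x, y)"
    using L2_rv_mult_integrable[OF L2 L2]
    by (simp add: cov block_cov_def swap_both swap_left)
qed

section \<open>Covariances of the gradient and the Hessian blocks\<close>

lemma inner_dir [simp]:
  "dir1 i \<bullet> dir1 j = kronecker i j" "dir2 i \<bullet> dir2 j = kronecker i j"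
  "dir1 i \<bullet> dir2 j = 0" "dir2 i \<bullet> dir1 j = 0"
  by (simp_all add: dir1_def dir2_def kronecker_def inner_axis_axis)

lemma swap_dir [simp]: "prod.swap (dir1 i) = dir2 i" "prod.swap (dir2 i) = dir1 i"
  by (simp_all add: dir1_def dir2_def)

text \<open>The two general formulas \<open>first\<close> and \<open>second\<close> hold in arbitrary directions. For coordinate
  directions the flip exchanges \<open>dir1\<close> and \<open>dir2\<close>, which decides in each block which of the inner
  products survive.\<close>
theorem theorem19:
  fixes M :: "'w measure"
    and u f :: "(real^'d) \<times> (real^'d) \<Rightarrow> 'w \<Rightarrow> real"
    and h h' h'' :: "real \<Rightarrow> real"
    and zs :: "real^'d"
    and z :: "(real^'d) \<times> (real^'d)"
  assumes "prob_space M"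
    and "centered_isotropic_gaussian_field M u h"
    and "Cn 4 (cov_fun M u)"
    and "C2_on_nonneg h h' h''"
    and "f = block_field u"
    and "z = (zs, zs)"
  shows "\<forall>i j k l.
      covariance M (block_grad M f z i) (block_grad M f z j) = - 4 * h' 0 * kronecker i j \<and>
      covariance M (block_hess11 M f z i j) (block_hess11 M f z k l)
        = 8 * h'' 0 * (kronecker i k * kronecker j l + kronecker i l * kronecker j k) \<and>
      covariance M (block_hess12 M f z i j) (block_hess12 M f z k l)
        = 8 * h'' 0 * (kronecker i k * kronecker j l - kronecker i l * kronecker j k)"
proof -
  interpret prob_space M by fact
  define \<Phi> where "\<Phi> = (\<lambda>r::(real^'d) \<times> (real^'d). h ((norm r)\<^sup>2))"
  \<comment> \<open>The regularity of \<open>\<Phi>\<close> comes from \<open>k\<^sub>u(r, 0)\<close>, not from that of \<open>h\<close>.\<close>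
  have \<Phi>_cov: "\<Phi> = (\<lambda>r. cov_fun M u (r, 0))"
    using assms(2) unfolding centered_isotropic_gaussian_field_def \<Phi>_def
    by (metis (no_types) diff_zero)
  have lin: "bounded_linear (\<lambda>r::(real^'d) \<times> (real^'d). (r, 0::(real^'d) \<times> (real^'d)))"
    by (intro bounded_linear_Pair bounded_linear_ident bounded_linear_zero)
  have C4: "Cn 4 \<Phi>" unfolding \<Phi>_cov by (rule Cn_comp_linear(1)[OF lin assms(3)])
  then have C2: "Cn 2 \<Phi>"
    using Cn_SucD[of 2 \<Phi>] Cn_SucD[of 3 \<Phi>] by (simp add: eval_nat_numeral)
  have h: "(h has_real_derivative h' t) (at t within {0..})" if "t \<ge> 0" for t
    using assms(4) that by (simp add: C2_on_nonneg_def)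
  have h': "(h' has_real_derivative h'' 0) (at 0 within {0..})"
    using assms(4) by (simp add: C2_on_nonneg_def)
  have field: "centered_L2_field M f" and cov: "(LINT \<omega>|M. f x \<omega> * f y \<omega>) = block_cov h (x, y)" for x y
    unfolding assms(5) by (rule block_field_covariance[OF assms(2)])+
  have L2: "L2_rv M (f x)" for x by (rule centered_L2_fieldD(1)[OF field])
  note Cn_cov = Cn_block_cov[OF C2[unfolded \<Phi>_def]] Cn_block_cov[OF C4[unfolded \<Phi>_def]]
  have mean1: "(LINT \<omega>|M. ms_deriv M a f z \<omega>) = 0" for a
    by (rule centered_L2_fieldD(2)[OF ms_deriv_centered_L2_field[of f "block_cov h",
            OF field cov Cn_cov(1)]])
  have mean2: "(LINT \<omega>|M. ms_deriv M a (ms_deriv M b f) z \<omega>) = 0" for a b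
    by (rule centered_L2_fieldD(2)[OF ms_deriv2(1)[of f "block_cov h",
            OF field cov Cn_cov(2)]])
  note h0 = h[OF order_refl]
  note radial = iter_deriv_radial_2[of h "h' 0", OF C2[unfolded \<Phi>_def] h0]
    iter_deriv_radial_4[of h h' "h'' 0", OF C4[unfolded \<Phi>_def] h h']
  have first: "covariance M (ms_deriv M a f z) (ms_deriv M b f z)
      = 4 * h' 0 * (a \<bullet> prod.swap b - a \<bullet> b)" for a b
  proof -
    have "covariance M (ms_deriv M a f z) (ms_deriv M b f z)
        = iter_deriv [(a, 0), (0, b)] (block_cov h) ((zs, zs), (zs, zs))"
      unfolding assms(6)[symmetric]
      by (simp only: covariance_centered mean1 ms_deriv_inner[of f "block_cov h", OF L2 cov Cn_cov(1)])
    also have "\<dots> = 4 * h' 0 * (a \<bullet> prod.swap b - a \<bullet> b)"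
      by (subst iter_deriv_block_cov[OF C2[unfolded \<Phi>_def]])
        (simp_all add: radial swap_0 algebra_simps del: iter_deriv.simps)
    finally show ?thesis .
  qed
  have second: "covariance M (ms_deriv M a (ms_deriv M b f) z) (ms_deriv M c (ms_deriv M d f) z)
      = 8 * h'' 0 * ((a \<bullet> c) * (b \<bullet> d) + (a \<bullet> d) * (b \<bullet> c)
        - (a \<bullet> prod.swap c) * (b \<bullet> prod.swap d) - (a \<bullet> prod.swap d) * (b \<bullet> prod.swap c))" for a b c d
  proof -
    have "covariance M (ms_deriv M a (ms_deriv M b f) z) (ms_deriv M c (ms_deriv M d f) z)
        = iter_deriv [(b, 0), (0, d), (a, 0), (0, c)] (block_cov h) ((zs, zs), (zs, zs))"
      unfolding assms(6)[symmetric]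
      by (simp only: covariance_centered mean2 ms_deriv2(2)[of f "block_cov h", OF field cov Cn_cov(2)])
    also have "\<dots> = 8 * h'' 0 * ((a \<bullet> c) * (b \<bullet> d) + (a \<bullet> d) * (b \<bullet> c)
        - (a \<bullet> prod.swap c) * (b \<bullet> prod.swap d) - (a \<bullet> prod.swap d) * (b \<bullet> prod.swap c))"
      by (subst iter_deriv_block_cov[OF C4[unfolded \<Phi>_def]])
        (simp_all add: radial swap_0 inner_swap inner_commute algebra_simps del: iter_deriv.simps)
    finally show ?thesis .
  qed
  show ?thesis
    unfolding block_grad_def block_hess11_def block_hess12_def first second
    by simp
qed

end
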